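(* Let $H$ be a finite graph and let $f_2(n,H)$ be as defined in the context. Then: (i) If $H$ is a forest, then $f_2(n,H)=\Theta(n^2)$. If $H$ is not a forest, then there is a constant $\varepsilon=\varepsilon(H)>0$ such that $f_2(n,H)=O(n^{2-\varepsilon})$. (ii) If $H$ is non-bipartite, then $f_2(n,H)\leq n+1$. (iii) If $H$ is bipartite and $e(H)\geq 2|V(H)|-2$, then $f_2(n,H)=\Theta(n)$. (iv) There exist a bipartite graph $H$ and a constant $\varepsilon>0$ such that $n^{1+\varepsilon}\leq f_2(n,H)\leq n^{2-\varepsilon}$ for all sufficiently large $n$.
   Context: All colourings are edge-colourings of the complete graph $K_n$; a colouring is proper if any two edges sharing a vertex receive different colours. Two copies of a graph $H$ in an edge-coloured $K_n$ are colour isomorphic if there is a graph isomorphism between them that maps each edge to an edge of the same colour. A $k$-repeat of $H$ (or "$k$ repeats of $H$") is a collection of $k$ pairwise vertex-disjoint, pairwise colour-isomorphic copies of $H$. For integers $k,n\geq 2$ and a graph $H$, $f_k(n,H)$ denotes the smallest integer $C$ such that there is a proper edge-colouring of $K_n$ with $C$ colours containing no $k$-repeat of $H$. Asymptotic notation is with respect to $n\to\infty$, all other parameters ($H$, $k$) being fixed constants. *)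

theory Defs
  imports Complex_Main "HOL-Library.Landau_Symbols"
begin

record 'a sgraph =
  verts :: "'a set"
  edges :: "'a set set"

definition fin_graph :: "'a sgraph \<Rightarrow> bool" where
  "fin_graph G \<longleftrightarrow> finite (verts G) \<and> (\<forall>e \<in> edges G. e \<subseteq> verts G \<and> card e = 2)"

definition bipartite :: "'a sgraph \<Rightarrow> bool" where
  "bipartite G \<longleftrightarrow>
     (\<exists>A B. A \<union> B = verts G \<and> A \<inter> B = {} \<and> (\<forall>e \<in> edges G. \<exists>a \<in> A. \<exists>b \<in> B. e = {a, b}))"

definition is_cycle :: "'a sgraph \<Rightarrow> 'a list \<Rightarrow> bool" where
  "is_cycle G xs \<longleftrightarrow> 3 \<le> length xs \<and> distinct xs \<and>
     (\<forall>i < length xs. {xs ! i, xs ! (Suc i mod length xs)} \<in> edges G)"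

definition forest :: "'a sgraph \<Rightarrow> bool" where
  "forest G \<longleftrightarrow> (\<nexists>xs. is_cycle G xs)"

definition subgraph_of :: "'a sgraph \<Rightarrow> 'a sgraph \<Rightarrow> bool" where
  "subgraph_of F G \<longleftrightarrow> fin_graph F \<and> verts F \<subseteq> verts G \<and> edges F \<subseteq> edges G"

definition graph_iso :: "('a \<Rightarrow> 'b) \<Rightarrow> 'a sgraph \<Rightarrow> 'b sgraph \<Rightarrow> bool" where
  "graph_iso \<phi> G H \<longleftrightarrow> bij_betw \<phi> (verts G) (verts H) \<and>
     (\<forall>u \<in> verts G. \<forall>v \<in> verts G. {u, v} \<in> edges G \<longleftrightarrow> {\<phi> u, \<phi> v} \<in> edges H)"

text \<open>Copies are subgraphs, not necessarily induced.\<close>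
definition is_copy :: "'a sgraph \<Rightarrow> 'b sgraph \<Rightarrow> 'b sgraph \<Rightarrow> bool" where
  "is_copy H G F \<longleftrightarrow> subgraph_of F G \<and> (\<exists>\<phi>. graph_iso \<phi> H F)"

definition complete_graph :: "nat \<Rightarrow> nat sgraph" where
  "complete_graph n = \<lparr>verts = {..<n}, edges = {e. e \<subseteq> {..<n} \<and> card e = 2}\<rparr>"

text \<open>
  An edge-colouring of a graph is a function on sets of vertices, of which only the values on the
  edges matter. The palette is \<open>{..<C}\<close>; not every colour has to be used, which does not affect
  the least possible \<open>C\<close>.
\<close>
definition proper_colouring :: "'a sgraph \<Rightarrow> nat \<Rightarrow> ('a set \<Rightarrow> nat) \<Rightarrow> bool" where
  "proper_colouring G C c \<longleftrightarrow> c ` edges G \<subseteq> {..<C} \<and>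
     (\<forall>e \<in> edges G. \<forall>e' \<in> edges G. e \<noteq> e' \<and> e \<inter> e' \<noteq> {} \<longrightarrow> c e \<noteq> c e')"

definition colour_isomorphic :: "('a set \<Rightarrow> nat) \<Rightarrow> 'a sgraph \<Rightarrow> 'a sgraph \<Rightarrow> bool" where
  "colour_isomorphic c F F' \<longleftrightarrow>
     (\<exists>\<phi>. graph_iso \<phi> F F' \<and> (\<forall>e \<in> edges F. c (\<phi> ` e) = c e))"

definition is_repeat :: "nat \<Rightarrow> 'a sgraph \<Rightarrow> 'b sgraph \<Rightarrow> ('b set \<Rightarrow> nat) \<Rightarrow> 'b sgraph set \<Rightarrow> bool" where
  "is_repeat k H G c S \<longleftrightarrow> finite S \<and> card S = k \<and> (\<forall>F \<in> S. is_copy H G F) \<and>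
     (\<forall>F \<in> S. \<forall>F' \<in> S. F \<noteq> F' \<longrightarrow> verts F \<inter> verts F' = {} \<and> colour_isomorphic c F F')"

definition repeat_free_colourable :: "nat \<Rightarrow> nat \<Rightarrow> 'a sgraph \<Rightarrow> nat \<Rightarrow> bool" where
  "repeat_free_colourable k n H C \<longleftrightarrow>
     (\<exists>c. proper_colouring (complete_graph n) C c \<and> (\<nexists>S. is_repeat k H (complete_graph n) c S))"

text \<open>
  For \<open>k \<ge> 2\<close> and \<open>H\<close> with at least one edge this minimum is attained, see
  \<open>repeat_free_number_attained\<close> below. If \<open>H\<close> has no edges, no suitable \<open>C\<close> exists for large \<open>n\<close>
  and the value is meaningless.
\<close>
definition repeat_free_number :: "nat \<Rightarrow> nat \<Rightarrow> 'a sgraph \<Rightarrow> nat" where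
  "repeat_free_number k n H = (LEAST C. repeat_free_colourable k n H C)"

lemma is_copy_edges_nonempty:
  assumes "fin_graph H" "edges H \<noteq> {}" "is_copy H G F"
  shows "edges F \<noteq> {}"
proof -
  obtain e where e: "e \<in> edges H" using assms(2) by blast
  then obtain u v where uv: "e = {u, v}" "u \<in> verts H" "v \<in> verts H"
    using assms(1) unfolding fin_graph_def by (metis card_2_iff insert_subset)
  then show ?thesis
    using e assms(3) unfolding is_copy_def graph_iso_def by blast
qed

lemma rainbow_no_repeat:
  assumes "fin_graph H" "edges H \<noteq> {}" "2 \<le> k" "inj_on c (edges G)"
  shows "\<not> is_repeat k H G c S"
proof
  assume S: "is_repeat k H G c S"
  then have "\<not> card S \<le> Suc 0"
    using assms(3) by (auto simp: is_repeat_def)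
  then obtain F F' where F: "F \<in> S" "F' \<in> S" "F \<noteq> F'"
    using S by (auto simp: is_repeat_def card_le_Suc0_iff_eq)
  have cp: "is_copy H G F" "is_copy H G F'" and dj: "verts F \<inter> verts F' = {}"
    and ci: "colour_isomorphic c F F'"
    using S F by (auto simp: is_repeat_def)
  obtain \<phi> where iso: "graph_iso \<phi> F F'" and col: "\<forall>e \<in> edges F. c (\<phi> ` e) = c e"
    using ci by (auto simp: colour_isomorphic_def)
  obtain e where e: "e \<in> edges F"
    using is_copy_edges_nonempty[OF assms(1,2) cp(1)] by blast
  have fF: "fin_graph F" "edges F \<subseteq> edges G" "fin_graph F'" "edges F' \<subseteq> edges G"
    using cp by (auto simp: is_copy_def subgraph_of_def)
  obtain u v where uv: "e = {u, v}" "u \<in> verts F" "v \<in> verts F"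
    using e fF(1) unfolding fin_graph_def by (metis card_2_iff insert_subset)
  have e': "\<phi> ` e \<in> edges F'"
    using iso e uv by (auto simp: graph_iso_def)
  then have "\<phi> ` e = e"
    using assms(4) col e fF by (meson inj_onD subsetD)
  then have "u \<in> verts F'"
    using e' fF(3) uv by (auto simp: fin_graph_def)
  then show False using dj uv by blast
qed

lemma repeat_free_number_attained:
  assumes "fin_graph H" "edges H \<noteq> {}" "2 \<le> k"
  shows "repeat_free_colourable k n H (repeat_free_number k n H)"
proof -
  let ?E = "edges (complete_graph n)"
  have "finite ?E"
    by (rule finite_subset[of _ "Pow {..<n}"]) (auto simp: complete_graph_def)
  then obtain c where c: "bij_betw c ?E {0..<card ?E}"
    using ex_bij_betw_finite_nat by blast
  then have inj: "inj_on c ?E" by (simp add: bij_betw_def)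
  have "proper_colouring (complete_graph n) (card ?E) c"
    using c inj unfolding proper_colouring_def bij_betw_def inj_on_def by fastforce
  then have "repeat_free_colourable k n H (card ?E)"
    using rainbow_no_repeat[OF assms inj] unfolding repeat_free_colourable_def by blast
  then show ?thesis
    unfolding repeat_free_number_def by (rule LeastI)
qed

end

(*
  Upper bounds. For non-bipartite H colour xy by x + y modulo an odd m. If phi is a colour
  isomorphism onto a disjoint copy, then d(x) = phi(x) - x mod m is never 0 and satisfies
  d(x) + d(y) = m on every edge, so "d < m/2" is a bipartition. In general one counts valid
  colourings of growing edge sets: if E has m edges on w vertices, C >= 8n and C^m is at least a
  large constant times n^(2w-2), then every further edge multiplies the number of valid
  colourings by at least C/2. Indeed a repeat F, F' created by the new edge determines the colours
  on F' from those on F, which costs the factor (C/2)^(m-1), and there are O(n^(2w-2)) such pairs.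
  Applied to H itself this gives O(n) when e(H) >= 2|V(H)| - 2, and applied to a cycle of length l
  in H it gives O(n^(2-2/l)).

  Lower bounds. Join the pairs (u,u') and (v,v') when uv and u'v' are disjoint edges of the same
  colour. This graph on about n^2 vertices has average degree about n^2/C and maximum degree at
  most n, and an embedding of H whose vertices use pairwise disjoint pairs is a repeat of H. Since
  a vertex has at most two neighbours containing a given point, forests embed greedily into a
  subgraph of large constant minimum degree. For the six-cycle take minimum degree D = n^(7/8)/8.
  Three disjoint pairs that pairwise have many common neighbours (a heavy triangle) span a
  six-cycle, so without six-cycles a positive proportion of the pairs inside any large
  neighbourhood is light. Hence some vertex r is light to a set U of at least D^2/96 vertices, and U contains on the order of
  D^2 |U|^2 / n^2 light pairs, more than the O(n |U|) pairs x, y for which the closed walk through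
  r, x, y is degenerate.
*)
theory Submission
  imports Defs "HOL-Library.FuncSet" "HOL-Analysis.Convex" "HOL-Real_Asymp.Real_Asymp"
begin

section \<open>Repeats as pairs of embeddings\<close>

text \<open>A 2-repeat is recorded by its two embeddings instead of by subgraphs, so that repeats
  can be counted and restricted. \<open>W\<close> and \<open>E\<close> are free arguments because
  the counting argument may forbid twins of a mere part of \<open>H\<close>, such as one
  cycle.\<close>

definition twin :: "nat \<Rightarrow> (nat set \<Rightarrow> nat) \<Rightarrow> 'a set \<Rightarrow> 'a set set \<Rightarrow> ('a \<Rightarrow> nat) \<Rightarrow> ('a \<Rightarrow> nat) \<Rightarrow> bool" where
  "twin n c W E \<alpha> \<beta> \<longleftrightarrow> inj_on \<alpha> W \<and> inj_on \<beta> W \<and> \<alpha> ` W \<subseteq> {..<n} \<and> \<beta> ` W \<subseteq> {..<n} \<and>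
     \<alpha> ` W \<inter> \<beta> ` W = {} \<and> (\<forall>f \<in> E. c (\<alpha> ` f) = c (\<beta> ` f))"

lemma twin_sym: "twin n c W E \<alpha> \<beta> \<Longrightarrow> twin n c W E \<beta> \<alpha>"
  unfolding twin_def by (simp add: Int_commute)

text \<open>This lets a part of \<open>H\<close> stand in for \<open>H\<close>: a colouring without
  twins of the part has no twins of the whole.\<close>

lemma twin_mono:
  assumes t: "twin n c W E \<alpha> \<beta>" and sub: "W' \<subseteq> W" "E' \<subseteq> E"
  shows "twin n c W' E' \<alpha> \<beta>"
proof -
  have a: "\<alpha> ` W' \<subseteq> \<alpha> ` W" and b: "\<beta> ` W' \<subseteq> \<beta> ` W"
    using sub by auto
  show ?thesis
    unfolding twin_def
  proof (intro conjI)
    show "inj_on \<alpha> W'" "inj_on \<beta> W'"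
      using t sub(1) by (auto simp: twin_def intro: inj_on_subset)
    show "\<alpha> ` W' \<subseteq> {..<n}"
      using a by (rule order_trans) (use t in \<open>simp add: twin_def\<close>)
    show "\<beta> ` W' \<subseteq> {..<n}"
      using b by (rule order_trans) (use t in \<open>simp add: twin_def\<close>)
    have "\<alpha> ` W' \<inter> \<beta> ` W' \<subseteq> \<alpha> ` W \<inter> \<beta> ` W"
      using a b by (rule Int_mono)
    also have "\<dots> = {}"
      using t by (simp add: twin_def)
    finally show "\<alpha> ` W' \<inter> \<beta> ` W' = {}"
      by (simp only: subset_empty)
    show "\<forall>f \<in> E'. c (\<alpha> ` f) = c (\<beta> ` f)"
      using t sub(2) by (auto simp: twin_def)
  qed
qed

lemma fin_graph_edgeE:
  assumes "fin_graph H" "e \<in> edges H"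
  obtains u v where "e = {u, v}" "u \<noteq> v" "u \<in> verts H" "v \<in> verts H"
  using assms unfolding fin_graph_def by (metis card_2_iff insert_subset)

text \<open>One embedding is the isomorphism from \<open>H\<close> to the first copy, the other its
  composition with the colour isomorphism between the copies.\<close>

lemma twin_of_repeat:
  assumes H: "fin_graph H" and S: "is_repeat 2 H (complete_graph n) c S"
  obtains \<alpha> \<beta> where "twin n c (verts H) (edges H) \<alpha> \<beta>"
proof -
  have "\<not> card S \<le> Suc 0"
    using S by (auto simp: is_repeat_def)
  moreover have "finite S"
    using S by (simp add: is_repeat_def)
  ultimately obtain F F' where F: "F \<in> S" "F' \<in> S" "F \<noteq> F'"
    by (auto simp: card_le_Suc0_iff_eq)
  have cp: "is_copy H (complete_graph n) F" "is_copy H (complete_graph n) F'"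
    and dj: "verts F \<inter> verts F' = {}" and ci: "colour_isomorphic c F F'"
    using S F by (auto simp: is_repeat_def)
  obtain \<psi> where iso: "graph_iso \<psi> F F'" and col: "\<forall>e \<in> edges F. c (\<psi> ` e) = c e"
    using ci by (auto simp: colour_isomorphic_def)
  obtain \<phi> where phi: "graph_iso \<phi> H F"
    using cp by (auto simp: is_copy_def)
  have sub: "verts F \<subseteq> {..<n}" "verts F' \<subseteq> {..<n}"
    using cp by (auto simp: is_copy_def subgraph_of_def complete_graph_def)
  have b1: "bij_betw \<phi> (verts H) (verts F)" and b2: "bij_betw \<psi> (verts F) (verts F')"
    using phi iso by (auto simp: graph_iso_def)
  have b3: "bij_betw (\<psi> \<circ> \<phi>) (verts H) (verts F')"
    using b1 b2 by (rule bij_betw_trans)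
  have "c (\<phi> ` f) = c ((\<psi> \<circ> \<phi>) ` f)" if f: "f \<in> edges H" for f
  proof -
    obtain u v where "f = {u, v}" "u \<in> verts H" "v \<in> verts H"
      using fin_graph_edgeE[OF H f] by metis
    then have "\<phi> ` f \<in> edges F"
      using phi f by (auto simp: graph_iso_def)
    then show ?thesis
      using col by (auto simp: image_comp)
  qed
  then have "twin n c (verts H) (edges H) \<phi> (\<psi> \<circ> \<phi>)"
    unfolding twin_def using b1 b3 sub dj by (auto simp: bij_betw_def)
  then show ?thesis by (rule that)
qed

definition image_graph :: "('a \<Rightarrow> 'b) \<Rightarrow> 'a sgraph \<Rightarrow> 'b sgraph" where
  "image_graph \<alpha> H = \<lparr>verts = \<alpha> ` verts H, edges = (`) \<alpha> ` edges H\<rparr>"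

lemma image_graph_iso:
  assumes H: "fin_graph H" and inj: "inj_on \<alpha> (verts H)"
  shows "graph_iso \<alpha> H (image_graph \<alpha> H)"
proof -
  have "{u, v} \<in> edges H" if uv: "u \<in> verts H" "v \<in> verts H" "{\<alpha> u, \<alpha> v} \<in> (`) \<alpha> ` edges H" for u v
  proof -
    obtain e where e: "e \<in> edges H" "\<alpha> ` e = \<alpha> ` {u, v}"
      using uv by auto
    have "e \<subseteq> verts H" using H e by (auto simp: fin_graph_def)
    then have "e = {u, v}"
      using inj_on_image_eq_iff[OF inj, of e "{u, v}"] e uv by auto
    then show ?thesis using e by simp
  qed
  then show ?thesis
    using inj unfolding graph_iso_def image_graph_def bij_betw_def
    by (auto intro!: image_eqI[where x = "{_, _}"])
qed

lemma image_graph_copy: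
  assumes H: "fin_graph H" and inj: "inj_on \<alpha> (verts H)" and sub: "\<alpha> ` verts H \<subseteq> {..<n}"
  shows "is_copy H (complete_graph n) (image_graph \<alpha> H)"
proof -
  have "\<alpha> ` e \<subseteq> \<alpha> ` verts H \<and> card (\<alpha> ` e) = 2" if "e \<in> edges H" for e
    using H inj that unfolding fin_graph_def
    by (metis card_image image_mono inj_on_subset)
  then have "subgraph_of (image_graph \<alpha> H) (complete_graph n)"
    using H sub unfolding subgraph_of_def fin_graph_def image_graph_def complete_graph_def
    by auto
  then show ?thesis
    using image_graph_iso[OF H inj] unfolding is_copy_def by blast
qed

text \<open>The colour isomorphism is \<beta> after the inverse of \<alpha>.\<close>

lemma twin_colour_isomorphic:
  assumes H: "fin_graph H" and t: "twin n c (verts H) (edges H) \<alpha> \<beta>"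
  shows "colour_isomorphic c (image_graph \<alpha> H) (image_graph \<beta> H)"
proof -
  have inj: "inj_on \<alpha> (verts H)" "inj_on \<beta> (verts H)"
    using t by (auto simp: twin_def)
  define \<gamma> where "\<gamma> = inv_into (verts H) \<alpha>"
  have g: "\<gamma> (\<alpha> x) = x" if "x \<in> verts H" for x
    using that inj by (simp add: \<gamma>_def)
  have gi: "\<gamma> ` \<alpha> ` e = e" if "e \<subseteq> verts H" for e
    using g that by (force simp: image_iff)
  have i1: "graph_iso \<alpha> H (image_graph \<alpha> H)" and i2: "graph_iso \<beta> H (image_graph \<beta> H)"
    using image_graph_iso[OF H] inj by auto
  have bij: "bij_betw \<gamma> (verts (image_graph \<alpha> H)) (verts H)"
    unfolding \<gamma>_def using i1 by (auto simp: graph_iso_def intro: bij_betw_inv_into)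
  have "graph_iso (\<beta> \<circ> \<gamma>) (image_graph \<alpha> H) (image_graph \<beta> H)"
    unfolding graph_iso_def
  proof (intro conjI ballI)
    show "bij_betw (\<beta> \<circ> \<gamma>) (verts (image_graph \<alpha> H)) (verts (image_graph \<beta> H))"
      using bij i2 unfolding graph_iso_def by (blast intro: bij_betw_trans)
    fix u v assume "u \<in> verts (image_graph \<alpha> H)" "v \<in> verts (image_graph \<alpha> H)"
    then obtain x y where "u = \<alpha> x" "v = \<alpha> y" "x \<in> verts H" "y \<in> verts H"
      by (auto simp: image_graph_def)
    then show "({u, v} \<in> edges (image_graph \<alpha> H)) \<longleftrightarrow>
        ({(\<beta> \<circ> \<gamma>) u, (\<beta> \<circ> \<gamma>) v} \<in> edges (image_graph \<beta> H))"
      using i1 i2 g unfolding graph_iso_def by (metis comp_apply)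
  qed
  moreover have "c ((\<beta> \<circ> \<gamma>) ` e) = c e" if e: "e \<in> edges (image_graph \<alpha> H)" for e
  proof -
    obtain f where f: "f \<in> edges H" "e = \<alpha> ` f"
      using e by (auto simp: image_graph_def)
    then have "\<gamma> ` e = f" using H gi by (auto simp: fin_graph_def)
    then show ?thesis
      using t f unfolding twin_def by (metis image_comp)
  qed
  ultimately show ?thesis unfolding colour_isomorphic_def by blast
qed

lemma repeat_of_twin:
  assumes H: "fin_graph H" "edges H \<noteq> {}" and t: "twin n c (verts H) (edges H) \<alpha> \<beta>"
  shows "\<exists>S. is_repeat 2 H (complete_graph n) c S"
proof -
  \<comment> \<open>An edge forces a vertex. Disjoint images of a nonempty set differ, so the set of
    the two copies really has cardinality 2.\<close>
  have ne: "verts H \<noteq> {}"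
    using H fin_graph_edgeE by (metis equals0I empty_iff)
  have dj: "verts (image_graph \<alpha> H) \<inter> verts (image_graph \<beta> H) = {}"
    using t by (auto simp: twin_def image_graph_def)
  moreover have "verts (image_graph \<alpha> H) \<noteq> {}"
    using ne by (simp add: image_graph_def)
  ultimately have neq: "image_graph \<alpha> H \<noteq> image_graph \<beta> H" by auto
  have "is_repeat 2 H (complete_graph n) c {image_graph \<alpha> H, image_graph \<beta> H}"
    unfolding is_repeat_def
    using neq dj image_graph_copy[OF H(1)] twin_colour_isomorphic[OF H(1)] t twin_sym[OF t]
    by (auto simp: twin_def)
  then show ?thesis by blast
qed

lemma repeat_free_colourable_iff:
  assumes "fin_graph H" "edges H \<noteq> {}"
  shows "repeat_free_colourable 2 n H C \<longleftrightarrow>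
    (\<exists>c. proper_colouring (complete_graph n) C c \<and> (\<nexists>\<alpha> \<beta>. twin n c (verts H) (edges H) \<alpha> \<beta>))"
proof -
  have "(\<exists>S. is_repeat 2 H (complete_graph n) c S) \<longleftrightarrow> (\<exists>\<alpha> \<beta>. twin n c (verts H) (edges H) \<alpha> \<beta>)" for c
    using repeat_of_twin[OF assms] twin_of_repeat[OF assms(1)] by metis
  then show ?thesis unfolding repeat_free_colourable_def by simp
qed

lemma repeat_free_number_le:
  assumes "fin_graph H" "edges H \<noteq> {}" "proper_colouring (complete_graph n) C c"
    "\<And>\<alpha> \<beta>. \<not> twin n c (verts H) (edges H) \<alpha> \<beta>"
  shows "repeat_free_number 2 n H \<le> C"
  unfolding repeat_free_number_def
proof (rule Least_le)
  show "repeat_free_colourable 2 n H C"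
    unfolding repeat_free_colourable_iff[OF assms(1,2)] using assms(3,4) by (intro exI[of _ c]) simp
qed

lemma repeat_free_number_colouring:
  assumes "fin_graph H" "edges H \<noteq> {}"
  obtains c where "proper_colouring (complete_graph n) (repeat_free_number 2 n H) c"
    "\<And>\<alpha> \<beta>. \<not> twin n c (verts H) (edges H) \<alpha> \<beta>"
proof -
  obtain c where "proper_colouring (complete_graph n) (repeat_free_number 2 n H) c"
    "\<nexists>\<alpha> \<beta>. twin n c (verts H) (edges H) \<alpha> \<beta>"
    using repeat_free_number_attained[OF assms order.refl, of n]
    unfolding repeat_free_colourable_iff[OF assms] by (elim exE conjE)
  then show ?thesis using that[of c] by blast
qed

lemma doubleton_in_complete_graph [simp]:
  "{x, y} \<in> edges (complete_graph n) \<longleftrightarrow> x \<noteq> y \<and> x < n \<and> y < n"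
  by (cases "x = y") (auto simp: complete_graph_def)

lemma complete_graph_edgeE:
  assumes e: "e \<in> edges (complete_graph n)"
  obtains x y where "e = {x, y}" "x < y" "y < n"
proof -
  have "card e = 2" "e \<subseteq> {..<n}"
    using e by (auto simp: complete_graph_def)
  then obtain a b where "e = {a, b}" "a \<noteq> b" "a < n" "b < n"
    by (auto simp: card_2_iff)
  then show thesis
    using that[of a b] that[of b a] by (cases a b rule: linorder_cases) (auto simp: insert_commute)
qed

section \<open>Elementary bounds: rainbow colourings, stars, and sums modulo an odd number\<close>

lemma repeat_free_number_le_square:
  assumes "fin_graph H" "edges H \<noteq> {}"
  shows "repeat_free_number 2 n H \<le> n ^ 2"
proof -
  \<comment> \<open>The endpoints of an edge are the two base-\<open>n\<close> digits of its colour,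
    so all edges get distinct colours and no repeat exists.\<close>
  define c :: "nat set \<Rightarrow> nat" where "c e = n * Min e + Max e" for e
  have ed: "e = {Min e, Max e} \<and> Min e < n \<and> Max e < n" if "e \<in> edges (complete_graph n)" for e
  proof -
    obtain x y where "e = {x, y}" "x < y" "y < n"
      using complete_graph_edgeE \<open>e \<in> edges (complete_graph n)\<close> by blast
    then show ?thesis by simp
  qed
  have inj: "inj_on c (edges (complete_graph n))"
  proof (rule inj_onI)
    fix e e' assume e: "e \<in> edges (complete_graph n)" "e' \<in> edges (complete_graph n)" "c e = c e'"
    have "c x div n = Min x \<and> c x mod n = Max x" if "x \<in> edges (complete_graph n)" for x
      using ed[OF that] by (simp add: c_def)
    then show "e = e'" using e ed by metis
  qed
  have "c e < n ^ 2" if "e \<in> edges (complete_graph n)" for e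
  proof -
    have "c e < n * Suc (Min e)" using ed[OF that] by (simp add: c_def)
    also have "\<dots> \<le> n * n" using ed[OF that] by (intro mult_le_mono2) simp
    finally show ?thesis by (simp add: power2_eq_square)
  qed
  then have "proper_colouring (complete_graph n) (n ^ 2) c"
    unfolding proper_colouring_def using inj by (auto simp: inj_on_def)
  moreover have "\<not> twin n c (verts H) (edges H) \<alpha> \<beta>" for \<alpha> \<beta>
    using repeat_of_twin[OF assms] rainbow_no_repeat[OF assms order.refl inj] by blast
  ultimately show ?thesis
    by (intro repeat_free_number_le[OF assms])
qed

text \<open>The \<open>n - 1\<close> edges at the vertex 0 need distinct colours.\<close>

lemma repeat_free_number_ge:
  assumes "fin_graph H" "edges H \<noteq> {}"
  shows "n - 1 \<le> repeat_free_number 2 n H"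
proof (cases "n = 0")
  case False
  obtain c where c: "proper_colouring (complete_graph n) (repeat_free_number 2 n H) c"
    by (rule repeat_free_number_colouring[OF assms])
  have ed: "{0, y} \<in> edges (complete_graph n)" if "y \<in> {1..<n}" for y
    using that by auto
  have "inj_on (\<lambda>y. c {0, y}) {1..<n}"
  proof (rule inj_onI, rule ccontr)
    fix x y assume xy: "x \<in> {1..<n}" "y \<in> {1..<n}" "c {0, x} = c {0, y}" "x \<noteq> y"
    then have "{0, x} \<noteq> {0, y}" by (auto simp: doubleton_eq_iff)
    moreover have "{0, x} \<inter> {0, y} \<noteq> {}" by blast
    ultimately show False
      using c ed[OF xy(1)] ed[OF xy(2)] xy(3) unfolding proper_colouring_def by metis
  qed
  moreover have "(\<lambda>y. c {0, y}) ` {1..<n} \<subseteq> {..<repeat_free_number 2 n H}"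
    using ed c unfolding proper_colouring_def by (auto simp: image_subset_iff)
  ultimately show ?thesis
    using card_inj_on_le[of "\<lambda>y. c {0, y}" "{1..<n}" "{..<repeat_free_number 2 n H}"] by simp
qed simp

lemma mod_add_less:
  fixes x y m :: nat
  assumes "x < m" "y < m"
  shows "(x + y) mod m = (if x + y < m then x + y else x + y - m)"
proof (cases "x + y < m")
  case False
  then have "(x + y) mod m = (x + y - m) mod m" by (intro le_mod_geq) simp
  also have "\<dots> = x + y - m" using assms False by (intro mod_less) linarith
  finally show ?thesis using False by simp
qed simp

lemma nonbipartite_upper:
  assumes H: "fin_graph H" "edges H \<noteq> {}" and nb: "\<not> bipartite H"
  shows "repeat_free_number 2 n H \<le> n + 1"
proof -
  \<comment> \<open>The odd one of \<open>n\<close> and \<open>n + 1\<close>: at least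
    \<open>n\<close> for properness, and odd so that 0 is the only residue equal to its own
    negative.\<close>
  define m where "m = (if odd n then n else n + 1)"
  have m: "odd m" "n \<le> m" "m \<le> n + 1" "0 < m" by (auto simp: m_def odd_pos)
  define c :: "nat set \<Rightarrow> nat" where "c e = \<Sum> e mod m" for e
  have c2: "c {x, y} = (x + y) mod m" if "x \<noteq> y" for x y
    using that by (simp add: c_def)
  have "proper_colouring (complete_graph n) (n + 1) c"
    unfolding proper_colouring_def
  proof (intro conjI ballI impI)
    have "c e < n + 1" for e
      unfolding c_def using m(3) mod_less_divisor[OF m(4), of "\<Sum> e"] by linarith
    then show "c ` edges (complete_graph n) \<subseteq> {..<n + 1}" by auto
    fix e e' assume e: "e \<in> edges (complete_graph n)" "e' \<in> edges (complete_graph n)"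
      and "e \<noteq> e' \<and> e \<inter> e' \<noteq> {}"
    then obtain x where x: "x \<in> e" "x \<in> e'" "e \<noteq> e'" by blast
    have other: "\<exists>y. f = {x, y} \<and> x \<noteq> y \<and> y < n" if "x \<in> f" "f \<in> edges (complete_graph n)" for f
      using that by (auto elim!: complete_graph_edgeE)
    obtain y z where yz: "e = {x, y}" "x \<noteq> y" "y < n" "e' = {x, z}" "x \<noteq> z" "z < n"
      using other e x by metis
    show "c e \<noteq> c e'"
    proof
      assume "c e = c e'"
      then have "(x + y) mod m = (x + z) mod m" using yz c2 by simp
      moreover have "x < n" using e(1) x(1) by (auto simp: complete_graph_def)
      ultimately have "y = z"
        using yz m(2) by (auto simp: mod_add_less split: if_splits)
      then show False using yz x by auto
    qed
  qed
  moreover have "\<not> twin n c (verts H) (edges H) \<alpha> \<beta>" for \<alpha> \<beta>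
  proof
    assume t: "twin n c (verts H) (edges H) \<alpha> \<beta>"
    \<comment> \<open>For vertices of \<open>H\<close>, \<open>d u\<close> is the representative of
      \<beta> u - \<alpha> u modulo \<open>m\<close> between 0 and \<open>m - 1\<close>.
      Disjointness excludes 0, so on an edge \<open>d u + d v\<close> is a multiple of
      \<open>m\<close> strictly between 0 and \<open>2 * m\<close>.\<close>
    define d where "d u = (if \<alpha> u \<le> \<beta> u then \<beta> u - \<alpha> u else \<beta> u + m - \<alpha> u)" for u
    have sum: "d u + d v = m" if uv: "{u, v} \<in> edges H" "u \<in> verts H" "v \<in> verts H" "u \<noteq> v" for u v
    proof -
      have "\<alpha> u \<noteq> \<alpha> v" "\<beta> u \<noteq> \<beta> v"
        using uv t by (auto simp: twin_def dest: inj_onD)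
      then have eq: "(\<alpha> u + \<alpha> v) mod m = (\<beta> u + \<beta> v) mod m"
        using t uv(1) c2 unfolding twin_def by force
      have lt: "\<alpha> u < m" "\<alpha> v < m" "\<beta> u < m" "\<beta> v < m"
        using uv t m(2) by (auto simp: twin_def)
      have neq: "\<alpha> u \<noteq> \<beta> u" "\<alpha> v \<noteq> \<beta> v"
        using uv t by (auto simp: twin_def)
      show ?thesis
        using eq lt neq unfolding d_def mod_add_less[OF lt(1,2)] mod_add_less[OF lt(3,4)]
        by (auto split: if_splits)
    qed
    have "bipartite H"
      unfolding bipartite_def
    proof (intro exI conjI ballI)
      show "{u \<in> verts H. 2 * d u < m} \<union> {u \<in> verts H. \<not> 2 * d u < m} = verts H"
        "{u \<in> verts H. 2 * d u < m} \<inter> {u \<in> verts H. \<not> 2 * d u < m} = {}" by auto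
      fix e assume e: "e \<in> edges H"
      obtain u v where uv: "e = {u, v}" "u \<noteq> v" "u \<in> verts H" "v \<in> verts H"
        using fin_graph_edgeE[OF H(1) e] by metis
      have "d u + d v = m" using sum uv e by blast
      \<comment> \<open>As \<open>m\<close> is odd, \<open>d u\<close> is never half of it, so
        exactly one end of the edge lies below the half.\<close>
      moreover have "2 * d u \<noteq> m" using m(1) by auto
      ultimately have "(2 * d u < m) \<noteq> (2 * d v < m)" by linarith
      then show "\<exists>a\<in>{u \<in> verts H. 2 * d u < m}. \<exists>b\<in>{u \<in> verts H. \<not> 2 * d u < m}. e = {a, b}"
        using uv by (auto simp: insert_commute)
    qed
    then show False using nb by simp
  qed
  ultimately show ?thesis
    by (intro repeat_free_number_le[OF H])
qed

section \<open>Upper bounds by counting colourings\<close>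

text \<open>Functions are extensional on \<open>S\<close>, so for finite \<open>S\<close> the
  cardinality counts partial colourings. Twins are forbidden only if all edges of both copies lie in
  \<open>S\<close>, which makes the notion hereditary and, for nonempty \<open>E\<close>, vacuous at
  \<open>S = {}\<close>.\<close>

definition valid_colourings :: "nat \<Rightarrow> nat \<Rightarrow> 'a set \<Rightarrow> 'a set set \<Rightarrow> nat set set \<Rightarrow> (nat set \<Rightarrow> nat) set" where
  "valid_colourings n C W E S = {c \<in> S \<rightarrow>\<^sub>E {..<C}.
     (\<forall>e \<in> S. \<forall>e' \<in> S. e \<noteq> e' \<and> e \<inter> e' \<noteq> {} \<longrightarrow> c e \<noteq> c e') \<and>
     (\<forall>\<alpha> \<beta>. (\<forall>f \<in> E. \<alpha> ` f \<in> S \<and> \<beta> ` f \<in> S) \<longrightarrow> \<not> twin n c W E \<alpha> \<beta>)}"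

lemma valid_colouringsD:
  assumes "c \<in> valid_colourings n C W E S"
  shows "c \<in> S \<rightarrow>\<^sub>E {..<C}"
    and "\<And>e e'. e \<in> S \<Longrightarrow> e' \<in> S \<Longrightarrow> e \<noteq> e' \<Longrightarrow> e \<inter> e' \<noteq> {} \<Longrightarrow> c e \<noteq> c e'"
    and "\<And>\<alpha> \<beta>. \<forall>f \<in> E. \<alpha> ` f \<in> S \<and> \<beta> ` f \<in> S \<Longrightarrow> \<not> twin n c W E \<alpha> \<beta>"
  using assms unfolding valid_colourings_def by simp_all

lemma valid_colouringsI:
  assumes "c \<in> S \<rightarrow>\<^sub>E {..<C}"
    and "\<And>e e'. e \<in> S \<Longrightarrow> e' \<in> S \<Longrightarrow> e \<noteq> e' \<Longrightarrow> e \<inter> e' \<noteq> {} \<Longrightarrow> c e \<noteq> c e'"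
    and "\<And>\<alpha> \<beta>. \<forall>f \<in> E. \<alpha> ` f \<in> S \<and> \<beta> ` f \<in> S \<Longrightarrow> \<not> twin n c W E \<alpha> \<beta>"
  shows "c \<in> valid_colourings n C W E S"
  using assms unfolding valid_colourings_def by simp

lemma finite_valid_colourings: "finite S \<Longrightarrow> finite (valid_colourings n C W E S)"
  unfolding valid_colourings_def by (rule finite_subset[of _ "S \<rightarrow>\<^sub>E {..<C}"]) (auto intro: finite_PiE)

lemma twin_cong:
  assumes "\<And>f. f \<in> E \<Longrightarrow> c (\<alpha> ` f) = c' (\<alpha> ` f) \<and> c (\<beta> ` f) = c' (\<beta> ` f)"
  shows "twin n c W E \<alpha> \<beta> \<longleftrightarrow> twin n c' W E \<alpha> \<beta>"
  using assms unfolding twin_def by auto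

text \<open>Replaces arbitrary embeddings by extensional ones; with values below \<open>n\<close>
  only finitely many of those exist, so they can be counted.\<close>

lemma twin_restrict:
  assumes "\<forall>f \<in> E. f \<subseteq> W"
  shows "twin n c W E (restrict \<alpha> W) (restrict \<beta> W) \<longleftrightarrow> twin n c W E \<alpha> \<beta>"
proof -
  have "restrict g W ` f = g ` f" if "f \<subseteq> W" for f and g :: "'a \<Rightarrow> nat"
    using that by (intro image_cong) auto
  then show ?thesis
    unfolding twin_def using assms by (simp cong: conj_cong ball_cong)
qed

lemma restrict_valid:
  assumes c: "c \<in> valid_colourings n C W E S" and sub: "S' \<subseteq> S"
  shows "restrict c S' \<in> valid_colourings n C W E S'"
proof (rule valid_colouringsI)
  show "restrict c S' \<in> S' \<rightarrow>\<^sub>E {..<C}"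
    using valid_colouringsD(1)[OF c] sub by (auto simp: PiE_iff)
  show "restrict c S' e \<noteq> restrict c S' e'" if "e \<in> S'" "e' \<in> S'" "e \<noteq> e'" "e \<inter> e' \<noteq> {}" for e e'
    using valid_colouringsD(2)[OF c, of e e'] that sub by (simp add: subset_iff)
  show "\<not> twin n (restrict c S') W E \<alpha> \<beta>" if im: "\<forall>f \<in> E. \<alpha> ` f \<in> S' \<and> \<beta> ` f \<in> S'" for \<alpha> \<beta>
  proof -
    have "twin n (restrict c S') W E \<alpha> \<beta> \<longleftrightarrow> twin n c W E \<alpha> \<beta>"
      using im by (intro twin_cong) auto
    then show ?thesis
      using valid_colouringsD(3)[OF c] im sub by (simp add: subset_iff)
  qed
qed

text \<open>Each of the two vertices of \<open>f\<close> goes to one of the two points of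
  \<open>e\<close>, giving the factor 4, and the other vertices of \<open>W\<close> are
  free.\<close>

lemma card_maps_hitting_edge:
  assumes W: "finite W" and f: "f \<subseteq> W" "card f = 2" and e: "finite e" "card e = 2"
  shows "card {\<beta> \<in> W \<rightarrow>\<^sub>E {..<n}. \<beta> ` f = e} \<le> 4 * n ^ (card W - 2)"
proof -
  let ?g = "\<lambda>x. if x \<in> f then e else {..<n}"
  have "{\<beta> \<in> W \<rightarrow>\<^sub>E {..<n}. \<beta> ` f = e} \<subseteq> PiE W ?g"
    by (auto simp: PiE_iff extensional_def)
  moreover have "finite (PiE W ?g)"
    using W e by (intro finite_PiE) auto
  ultimately have "card {\<beta> \<in> W \<rightarrow>\<^sub>E {..<n}. \<beta> ` f = e} \<le> card (PiE W ?g)"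
    by (rule card_mono[rotated])
  also have "\<dots> = (\<Prod>x\<in>W. card (?g x))"
    using W by (rule card_PiE)
  also have "\<dots> = (\<Prod>x\<in>W - f. card (?g x)) * (\<Prod>x\<in>f. card (?g x))"
    using W f by (intro prod.subset_diff) auto
  also have "(\<Prod>x\<in>f. card (?g x)) = 4"
    using f e by simp
  also have "(\<Prod>x\<in>W - f. card (?g x)) = n ^ (card W - 2)"
    using W f by (simp add: card_Diff_subset finite_subset)
  finally show ?thesis by simp
qed

lemma card_touching_edges:
  assumes S: "S \<subseteq> edges (complete_graph n)" and e: "e \<in> edges (complete_graph n)"
  shows "card {f \<in> S. f \<inter> e \<noteq> {}} \<le> 2 * n"
proof -
  obtain a b where ab: "e = {a, b}"
    using e by (elim complete_graph_edgeE)
  have "{f \<in> S. f \<inter> e \<noteq> {}} \<subseteq> (\<lambda>x. {a, x}) ` {..<n} \<union> (\<lambda>x. {b, x}) ` {..<n}"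
  proof
    fix f assume f: "f \<in> {f \<in> S. f \<inter> e \<noteq> {}}"
    then have "f \<in> edges (complete_graph n)" using S by auto
    then obtain x y where "f = {x, y}" "x < n" "y < n"
      by (elim complete_graph_edgeE) auto
    then show "f \<in> (\<lambda>x. {a, x}) ` {..<n} \<union> (\<lambda>x. {b, x}) ` {..<n}"
      using f ab by auto
  qed
  then have "card {f \<in> S. f \<inter> e \<noteq> {}} \<le> card ((\<lambda>x. {a, x}) ` {..<n} \<union> (\<lambda>x. {b, x}) ` {..<n})"
    by (intro card_mono) auto
  also have "\<dots> \<le> card ((\<lambda>x. {a, x}) ` {..<n}) + card ((\<lambda>x. {b, x}) ` {..<n})"
    by (rule card_Un_le)
  also have "\<dots> \<le> n + n"
    by (intro add_mono) (metis card_image_le card_lessThan finite_lessThan)+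
  finally show ?thesis by simp
qed

lemma finite_complete_graph: "finite (edges (complete_graph n))"
  by (rule finite_subset[of _ "Pow {..<n}"]) (auto simp: complete_graph_def)

text \<open>Of the \<open>C\<close> extensions of each valid colouring of \<open>S\<close> to
  \<open>e\<close>, two kinds are lost: those repeating the colour of an edge touching
  \<open>e\<close>, and those completing a twin. \<open>bC\<close> says that at least
  \<open>b\<close> per colouring are left. \<open>IH\<close> controls the second loss by comparing
  \<open>S\<close> with smaller edge sets.\<close>

lemma valid_colourings_step:
  fixes b :: real
  assumes W: "finite W" and E: "\<And>f. f \<in> E \<Longrightarrow> f \<subseteq> W \<and> card f = 2" "E \<noteq> {}"
    and b: "b > 0" and bC: "b + 2 * real n + 4 * card E * n ^ (2 * card W - 2) / b ^ (card E - 1) \<le> C"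
    and S: "insert e S \<subseteq> edges (complete_graph n)" and e: "e \<notin> S"
    and IH: "\<And>T. T \<subseteq> S \<Longrightarrow>
      b ^ card T * card (valid_colourings n C W E (S - T)) \<le> card (valid_colourings n C W E S)"
  shows "b * card (valid_colourings n C W E S) \<le> card (valid_colourings n C W E (insert e S))"
proof -
  define N where "N S = card (valid_colourings n C W E S)" for S
  define m where "m = card E"
  define M where "M = W \<rightarrow>\<^sub>E {..<n}"
  have fS: "finite S" using S finite_complete_graph by (auto intro: finite_subset)
  have eK: "e \<in> edges (complete_graph n)" using S by simp
  have fe: "finite e" "card e = 2"
    using eK by (auto simp: complete_graph_def intro: finite_subset)
  have fE: "finite E" by (rule finite_subset[of _ "Pow W"]) (use E W in auto)
  \<comment> \<open>All extensions by a colour at \<open>e\<close>, valid or not.\<close>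
  define X where "X = (\<lambda>(c, k). c(e := k)) ` (valid_colourings n C W E S \<times> {..<C})"
  have fX: "finite X" unfolding X_def by (intro finite_imageI finite_cartesian_product finite_valid_colourings fS finite_lessThan)
  have und: "c e = undefined" if "c \<in> valid_colourings n C W E S" for c
    using valid_colouringsD(1)[OF that] e by (auto simp: PiE_iff extensional_def)
  have inj: "inj_on (\<lambda>(c, k). c(e := k)) (valid_colourings n C W E S \<times> {..<C})"
  proof (rule inj_onI, clarify)
    fix c k c' k' assume c: "c \<in> valid_colourings n C W E S" "c' \<in> valid_colourings n C W E S"
      and eq: "c(e := k) = c'(e := k')"
    have "k = k'" using eq by (metis fun_upd_same)
    moreover have "c = c'"
    proof
      fix x show "c x = c' x"
        using fun_cong[OF eq, of x] und[OF c(1)] und[OF c(2)] by (cases "x = e") auto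
    qed
    ultimately show "c = c' \<and> k = k'" by simp
  qed
  have cX: "card X = N S * C"
    unfolding X_def N_def using inj by (simp add: card_image card_cartesian_product)
  have XD: "restrict c S \<in> valid_colourings n C W E S" "c \<in> insert e S \<rightarrow>\<^sub>E {..<C}" if "c \<in> X" for c
  proof -
    obtain c0 k where c0: "c0 \<in> valid_colourings n C W E S" "k < C" "c = c0(e := k)"
      using \<open>c \<in> X\<close> unfolding X_def by auto
    have ex: "c0 \<in> S \<rightarrow>\<^sub>E {..<C}" using valid_colouringsD(1)[OF c0(1)] .
    have "restrict c S = c0"
      using ex e c0 by (auto simp: restrict_def PiE_iff extensional_def fun_eq_iff)
    then show "restrict c S \<in> valid_colourings n C W E S" using c0 by simp
    show "c \<in> insert e S \<rightarrow>\<^sub>E {..<C}"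
      using ex c0 by (auto simp: PiE_iff extensional_def)
  qed
  have Xeq: "c = c'" if "c \<in> X" "c' \<in> X" "\<And>f. f \<in> insert e S \<Longrightarrow> c f = c' f" for c c'
    using XD(2)[OF that(1)] XD(2)[OF that(2)] that(3) by (rule PiE_ext)
  \<comment> \<open>The bad extensions: \<open>B1 f\<close> repeats the colour of \<open>f\<close>
    on \<open>e\<close>, and \<open>B2\<close> collects the colourings with a given twin.
    \<open>P\<close> lists the candidate pairs of maps in which \<open>e\<close> is an edge of the
    second copy.\<close>
  define B1 where "B1 f = {c \<in> X. c e = c f}" for f
  define P where "P = {(\<alpha>, \<beta>) \<in> M \<times> M. \<exists>f \<in> E. \<beta> ` f = e}"
  define B2 where "B2 = (\<lambda>(\<alpha>, \<beta>). {c \<in> X. twin n c W E \<alpha> \<beta> \<and> (\<forall>f \<in> E. \<alpha> ` f \<in> insert e S \<and> \<beta> ` f \<in> insert e S)})"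
  have cB1: "card (B1 f) \<le> N S" if f: "f \<in> S" for f
    unfolding N_def
  proof (rule card_inj_on_le[of "\<lambda>c. restrict c S"])
    show "inj_on (\<lambda>c. restrict c S) (B1 f)"
    proof (rule inj_onI)
      fix c c' assume c: "c \<in> B1 f" "c' \<in> B1 f" "restrict c S = restrict c' S"
      have "c x = c' x" if "x \<in> S" for x
        using fun_cong[OF c(3), of x] that by simp
      then show "c = c'"
        using c(1,2) f by (intro Xeq) (auto simp: B1_def)
    qed
  qed (use XD finite_valid_colourings[OF fS] in \<open>auto simp: B1_def\<close>)
  \<comment> \<open>With the twin fixed, the colours on the second copy are those on the first. A
    colouring in \<open>B2 p\<close> is thus determined by its values on \<open>S\<close> without
    the other \<open>m - 1\<close> edges of the second copy, and removing these costs the factor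
    \<open>b ^ (m - 1)\<close> by \<open>IH\<close>.\<close>
  have cB2: "b ^ (m - 1) * card (B2 p) \<le> N S" if p: "p \<in> P" for p
  proof (cases "B2 p = {}")
    case False
    obtain \<alpha> \<beta> where ab: "p = (\<alpha>, \<beta>)" by (cases p)
    obtain f0 where f0: "f0 \<in> E" "\<beta> ` f0 = e" using p ab by (auto simp: P_def)
    obtain c0 where c0: "twin n c0 W E \<alpha> \<beta>"
      and im: "\<And>f. f \<in> E \<Longrightarrow> \<alpha> ` f \<in> insert e S \<and> \<beta> ` f \<in> insert e S"
      using False unfolding B2_def ab by auto
    define D where "D = (`) \<beta> ` E"
    have dj: "\<alpha> ` W \<inter> \<beta> ` W = {}" and injb: "inj_on \<beta> W"
      using c0 by (auto simp: twin_def)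
    have "inj_on ((`) \<beta>) E"
      by (rule inj_on_subset[OF inj_on_image_Pow[OF injb]]) (use E in auto)
    then have cD: "card D = m" by (simp add: D_def m_def card_image)
    have eD: "e \<in> D" using f0 by (auto simp: D_def)
    have fD: "finite D" using fE by (simp add: D_def)
    have DS: "D - {e} \<subseteq> S"
    proof
      fix x assume "x \<in> D - {e}"
      then obtain f where "f \<in> E" "x = \<beta> ` f" "x \<noteq> e" by (auto simp: D_def)
      then show "x \<in> S" using im[of f] by simp
    qed
    have aD: "\<alpha> ` f \<in> S - D" if f: "f \<in> E" for f
    proof -
      have "\<alpha> ` f \<notin> D"
      proof
        assume "\<alpha> ` f \<in> D"
        then obtain g where g: "g \<in> E" "\<alpha> ` f = \<beta> ` g" by (auto simp: D_def)
        have "f \<noteq> {}" using E(1)[OF f] by auto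
        then obtain x where "x \<in> f" by blast
        then have "\<alpha> x \<in> \<alpha> ` W" "\<alpha> x \<in> \<beta> ` W"
          using E(1)[OF f] E(1)[OF g(1)] g(2) by blast+
        then show False using dj by blast
      qed
      then show ?thesis using im[OF f] eD by blast
    qed
    have "card (B2 p) \<le> N (S - (D - {e}))"
      unfolding N_def
    proof (rule card_inj_on_le[of "\<lambda>c. restrict c (S - (D - {e}))"])
      show "inj_on (\<lambda>c. restrict c (S - (D - {e}))) (B2 p)"
      proof (rule inj_onI)
        fix c c' assume c: "c \<in> B2 p" "c' \<in> B2 p"
          and eq: "restrict c (S - (D - {e})) = restrict c' (S - (D - {e}))"
        have same: "c x = c' x" if "x \<in> S - D" for x
          using fun_cong[OF eq, of x] that by simp
        have "c x = c' x" if x: "x \<in> insert e S" for x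
        proof (cases "x \<in> D")
          case True
          then obtain f where f: "f \<in> E" "x = \<beta> ` f" by (auto simp: D_def)
          then have "c x = c (\<alpha> ` f)" "c' x = c' (\<alpha> ` f)"
            using c by (auto simp: B2_def ab twin_def)
          then show ?thesis using same[OF aD[OF f(1)]] by simp
        qed (use same x eD in auto)
        then show "c = c'"
          using c by (intro Xeq) (auto simp: B2_def ab)
      qed
      have "restrict (restrict c S) (S - (D - {e})) = restrict c (S - (D - {e}))" for c :: "nat set \<Rightarrow> nat"
        by (auto simp: restrict_def fun_eq_iff)
      then show "(\<lambda>c. restrict c (S - (D - {e}))) ` B2 p \<subseteq> valid_colourings n C W E (S - (D - {e}))"
        using restrict_valid[OF XD(1), of _ "S - (D - {e})"] by (fastforce simp: B2_def ab)
      show "finite (valid_colourings n C W E (S - (D - {e})))"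
        using fS by (intro finite_valid_colourings) auto
    qed
    then have "b ^ (m - 1) * card (B2 p) \<le> b ^ (m - 1) * N (S - (D - {e}))"
      using b by (intro mult_left_mono) auto
    also have "card (D - {e}) = m - 1" using cD eD fD by simp
    then have "b ^ (m - 1) * N (S - (D - {e})) \<le> N S"
      using IH[OF DS] by (simp add: N_def)
    finally show ?thesis .
  qed simp
  have fM: "finite M" unfolding M_def using W by (intro finite_PiE) auto
  have fP: "finite P" by (rule finite_subset[of _ "M \<times> M"]) (use fM in \<open>auto simp: P_def\<close>)
  have w2: "card W \<ge> 2"
    using E W by (metis all_not_in_conv card_mono)
  have "P = (\<Union>f\<in>E. M \<times> {\<beta> \<in> M. \<beta> ` f = e})" by (auto simp: P_def)
  then have "card P \<le> (\<Sum>f\<in>E. card (M \<times> {\<beta> \<in> M. \<beta> ` f = e}))"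
    using card_UN_le[OF fE] by simp
  also have "\<dots> \<le> (\<Sum>f\<in>E. n ^ card W * (4 * n ^ (card W - 2)))"
    unfolding card_cartesian_product M_def using W E fe card_maps_hitting_edge[OF W _ _ fe]
    by (intro sum_mono mult_mono) (auto simp: card_PiE)
  also have "\<dots> = m * (4 * n ^ (card W + (card W - 2)))"
    by (simp add: m_def power_add)
  also have "card W + (card W - 2) = 2 * card W - 2" using w2 by simp
  finally have cP: "card P \<le> m * (4 * n ^ (2 * card W - 2))" .
  \<comment> \<open>An extension in no bad set is proper at \<open>e\<close>, and any twin it
    contains would have to use \<open>e\<close>.\<close>
  have cover: "X \<subseteq> valid_colourings n C W E (insert e S) \<union> (\<Union>f \<in> {f \<in> S. f \<inter> e \<noteq> {}}. B1 f) \<union> (\<Union>p \<in> P. B2 p)"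
  proof
    fix c assume c: "c \<in> X"
    note r = XD[OF c]
    have proper: "c f \<noteq> c f'" if "f \<in> S" "f' \<in> S" "f \<noteq> f'" "f \<inter> f' \<noteq> {}" for f f'
      using valid_colouringsD(2)[OF r(1) that] that by simp
    have notwin: "\<not> twin n c W E \<alpha> \<beta>" if im: "\<forall>f\<in>E. \<alpha> ` f \<in> S \<and> \<beta> ` f \<in> S" for \<alpha> \<beta>
    proof -
      have "\<not> twin n (restrict c S) W E \<alpha> \<beta>"
        using valid_colouringsD(3)[OF r(1) im] .
      then show ?thesis using im twin_cong[of E c \<alpha> "restrict c S" \<beta> n W] by auto
    qed
    show "c \<in> valid_colourings n C W E (insert e S) \<union> (\<Union>f \<in> {f \<in> S. f \<inter> e \<noteq> {}}. B1 f) \<union> (\<Union>p \<in> P. B2 p)"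
    proof (rule ccontr)
      assume neg: "\<not> ?thesis"
      have ne: "c f \<noteq> c e" if "f \<in> S" "f \<inter> e \<noteq> {}" for f
        using neg that c by (auto simp: B1_def)
      have pr: "c x \<noteq> c y" if "x \<in> insert e S" "y \<in> insert e S" "x \<noteq> y" "x \<inter> y \<noteq> {}" for x y
      proof -
        have "y \<inter> x \<noteq> {}" using that(4) by (simp add: Int_commute)
        then show ?thesis
          using that proper[of x y] ne[of x] ne[of y] by (cases "x = e"; cases "y = e") force+
      qed
      have "c \<notin> valid_colourings n C W E (insert e S)" using neg by simp
      then obtain \<alpha> \<beta> where im: "\<forall>f\<in>E. \<alpha> ` f \<in> insert e S \<and> \<beta> ` f \<in> insert e S"
        and t: "twin n c W E \<alpha> \<beta>"
      proof -
        have "\<exists>\<alpha> \<beta>. (\<forall>f\<in>E. \<alpha> ` f \<in> insert e S \<and> \<beta> ` f \<in> insert e S) \<and> twin n c W E \<alpha> \<beta>"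
        proof (rule ccontr)
          assume no: "\<nexists>\<alpha> \<beta>. (\<forall>f\<in>E. \<alpha> ` f \<in> insert e S \<and> \<beta> ` f \<in> insert e S) \<and> twin n c W E \<alpha> \<beta>"
          have "\<not> twin n c W E \<alpha> \<beta>" if "\<forall>f\<in>E. \<alpha> ` f \<in> insert e S \<and> \<beta> ` f \<in> insert e S" for \<alpha> \<beta>
            using no that by meson
          with r(2) pr have "c \<in> valid_colourings n C W E (insert e S)"
            by (rule valid_colouringsI)
          then show False using \<open>c \<notin> valid_colourings n C W E (insert e S)\<close> by simp
        qed
        then show thesis using that by (elim exE conjE)
      qed
      \<comment> \<open>Restricting the embeddings to \<open>W\<close> puts them into the counted
        set \<open>P\<close>. This treats \<open>e\<close> in the second copy; the other case swaps
        the copies.\<close>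
      have noP: "False" if im: "\<forall>f\<in>E. \<alpha> ` f \<in> insert e S \<and> \<beta> ` f \<in> insert e S"
        and t: "twin n c W E \<alpha> \<beta>" and f: "f \<in> E" "\<beta> ` f = e" for \<alpha> \<beta> f
      proof -
        have rI: "restrict g W ` f = g ` f" if "f \<in> E" for f and g :: "'a \<Rightarrow> nat"
          using E(1)[OF that] by (intro image_cong) auto
        have "(restrict \<alpha> W, restrict \<beta> W) \<in> P"
          using t f rI by (auto simp: P_def M_def twin_def)
        moreover have "c \<in> B2 (restrict \<alpha> W, restrict \<beta> W)"
          using c t im rI E(1) twin_restrict[of E W n c \<alpha> \<beta>] by (auto simp: B2_def)
        ultimately show False using neg by blast
      qed
      have "\<not> (\<forall>f\<in>E. \<alpha> ` f \<in> S \<and> \<beta> ` f \<in> S)"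
        using notwin t by meson
      then obtain f where f: "f \<in> E" "\<alpha> ` f = e \<or> \<beta> ` f = e"
        using im by auto
      from f(2) show False
      proof
        assume "\<beta> ` f = e"
        then show False using noP[OF im t f(1)] by simp
      next
        assume "\<alpha> ` f = e"
        moreover have "\<forall>f\<in>E. \<beta> ` f \<in> insert e S \<and> \<alpha> ` f \<in> insert e S" using im by simp
        ultimately show False using noP[OF _ twin_sym[OF t] f(1)] by simp
      qed
    qed
  qed
  have "card X \<le> card (valid_colourings n C W E (insert e S) \<union> (\<Union>f \<in> {f \<in> S. f \<inter> e \<noteq> {}}. B1 f) \<union> (\<Union>p \<in> P. B2 p))"
  proof (rule card_mono[OF _ cover])
    show "finite (valid_colourings n C W E (insert e S) \<union> (\<Union>f \<in> {f \<in> S. f \<inter> e \<noteq> {}}. B1 f) \<union> (\<Union>p \<in> P. B2 p))"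
      using fS fX fP by (auto simp: B1_def B2_def intro!: finite_valid_colourings)
  qed
  also have "\<dots> \<le> N (insert e S) + card (\<Union>f \<in> {f \<in> S. f \<inter> e \<noteq> {}}. B1 f) + card (\<Union>p \<in> P. B2 p)"
    unfolding N_def by (meson add_mono card_Un_le order_refl order_trans)
  finally have tot: "N S * C \<le> N (insert e S) + card (\<Union>f \<in> {f \<in> S. f \<inter> e \<noteq> {}}. B1 f) + card (\<Union>p \<in> P. B2 p)"
    using cX by simp
  have "card (\<Union>f \<in> {f \<in> S. f \<inter> e \<noteq> {}}. B1 f) \<le> (\<Sum>f \<in> {f \<in> S. f \<inter> e \<noteq> {}}. card (B1 f))"
    using fS by (intro card_UN_le) auto
  also have "\<dots> \<le> (\<Sum>f \<in> {f \<in> S. f \<inter> e \<noteq> {}}. N S)"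
    using cB1 by (intro sum_mono) auto
  also have "\<dots> \<le> 2 * n * N S"
    using card_touching_edges[OF _ eK, of S] S by simp
  finally have b1: "card (\<Union>f \<in> {f \<in> S. f \<inter> e \<noteq> {}}. B1 f) \<le> 2 * n * N S" .
  have "b ^ (m - 1) * card (\<Union>p \<in> P. B2 p) \<le> b ^ (m - 1) * (\<Sum>p \<in> P. card (B2 p))"
    using card_UN_le[OF fP, of B2] b by (intro mult_left_mono) (auto simp flip: of_nat_sum)
  also have "\<dots> = (\<Sum>p \<in> P. b ^ (m - 1) * card (B2 p))"
    by (simp add: sum_distrib_left)
  also have "\<dots> \<le> (\<Sum>p \<in> P. real (N S))"
    using cB2 by (intro sum_mono) auto
  also have "\<dots> \<le> real (m * (4 * n ^ (2 * card W - 2))) * N S"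
    using cP by (simp del: of_nat_mult of_nat_power add: mult_right_mono)
  finally have b2: "real (card (\<Union>p \<in> P. B2 p)) \<le> 4 * m * n ^ (2 * card W - 2) / b ^ (m - 1) * N S"
    using b by (simp add: field_simps)
  have "(b + 2 * n + 4 * m * n ^ (2 * card W - 2) / b ^ (m - 1)) * N S \<le> C * real (N S)"
    using bC by (intro mult_right_mono) (auto simp: m_def)
  moreover have "real (N S * C) \<le> real (N (insert e S)) + real (2 * n * N S) + 4 * m * n ^ (2 * card W - 2) / b ^ (m - 1) * N S"
    using tot b1 b2 by linarith
  ultimately show ?thesis
    by (simp add: N_def algebra_simps)
qed

text \<open>Edges of \<open>T\<close> are put back one at a time, each gaining a factor
  \<open>b\<close>. The induction keeps \<open>T\<close> arbitrary because the step for one edge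
  removes several edges from the smaller set at once.\<close>

lemma valid_colourings_growth:
  fixes b :: real
  assumes W: "finite W" and E: "\<And>f. f \<in> E \<Longrightarrow> f \<subseteq> W \<and> card f = 2" "E \<noteq> {}"
    and b: "b > 0" and bC: "b + 2 * real n + 4 * card E * n ^ (2 * card W - 2) / b ^ (card E - 1) \<le> C"
    and S: "S \<subseteq> edges (complete_graph n)" and T: "T \<subseteq> S"
  shows "b ^ card T * card (valid_colourings n C W E (S - T)) \<le> card (valid_colourings n C W E S)"
proof -
  have "finite S" using S finite_complete_graph by (rule finite_subset)
  then show ?thesis using S T
  proof (induction S arbitrary: T rule: finite_psubset_induct)
    case (psubset S)
    show ?case
    proof (cases "T = {}")
      case False
      then obtain e where e: "e \<in> T" by blast
      define S' where "S' = S - {e}"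
      have S': "insert e S' = S" "e \<notin> S'" "S' \<subset> S" "S' \<subseteq> edges (complete_graph n)"
        using e psubset.prems by (auto simp: S'_def)
      have fT: "finite T" using psubset by (meson finite_subset)
      have IH: "b ^ card T * card (valid_colourings n C W E (S' - T)) \<le> card (valid_colourings n C W E S')"
        if "T \<subseteq> S'" for T
        using psubset.IH[OF S'(3,4) that] .
      have "b ^ card T * card (valid_colourings n C W E (S - T))
          = b * (b ^ card (T - {e}) * card (valid_colourings n C W E (S' - (T - {e}))))"
      proof -
        have "S - T = S' - (T - {e})" using e by (auto simp: S'_def)
        moreover have "card T = Suc (card (T - {e}))" using e fT by (metis card_Suc_Diff1)
        ultimately show ?thesis by simp
      qed
      also have "\<dots> \<le> b * card (valid_colourings n C W E S')"
        using b psubset.prems S' by (intro mult_left_mono IH) auto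
      also have "\<dots> \<le> card (valid_colourings n C W E (insert e S'))"
        using psubset.prems S' by (intro valid_colourings_step[OF W E b bC _ S'(2) IH]) auto
      finally show ?thesis using S' by simp
    qed simp
  qed
qed

text \<open>With \<open>S\<close> and \<open>T\<close> both the full edge set, growth starts from
  the empty edge set, which has exactly one valid colouring. The number of valid colourings is then
  at least a power of \<open>b\<close>, hence positive.\<close>

lemma twin_free_colouring_exists:
  fixes b :: real
  assumes W: "finite W" and E: "\<And>f. f \<in> E \<Longrightarrow> f \<subseteq> W \<and> card f = 2" "E \<noteq> {}"
    and b: "b > 0" and bC: "b + 2 * real n + 4 * card E * n ^ (2 * card W - 2) / b ^ (card E - 1) \<le> C"
  obtains c where "proper_colouring (complete_graph n) C c" "\<And>\<alpha> \<beta>. \<not> twin n c W E \<alpha> \<beta>"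
proof -
  let ?K = "edges (complete_graph n)"
  have "valid_colourings n C W E {} = {\<lambda>_. undefined}"
    using E(2) by (auto simp: valid_colourings_def)
  then have "b ^ card ?K \<le> card (valid_colourings n C W E ?K)"
    using valid_colourings_growth[OF W E b bC order.refl order.refl] by simp
  moreover have "b ^ card ?K > 0" using b by simp
  ultimately have "valid_colourings n C W E ?K \<noteq> {}" by (metis card.empty not_less of_nat_0)
  then obtain c where c: "c \<in> valid_colourings n C W E ?K" by blast
  have "proper_colouring (complete_graph n) C c"
    using valid_colouringsD(1,2)[OF c] unfolding proper_colouring_def by (auto simp: PiE_iff)
  moreover have "\<not> twin n c W E \<alpha> \<beta>" for \<alpha> \<beta>
  proof
    assume t: "twin n c W E \<alpha> \<beta>"
    have "g ` f \<in> ?K" if "f \<in> E" "inj_on g W" "g ` W \<subseteq> {..<n}" for f g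
    proof -
      have "card (g ` f) = card f" using that E(1)[OF that(1)] by (meson card_image inj_on_subset)
      then show ?thesis using that E(1)[OF that(1)] unfolding complete_graph_def by auto
    qed
    then have "\<forall>f\<in>E. \<alpha> ` f \<in> ?K \<and> \<beta> ` f \<in> ?K" using t by (auto simp: twin_def)
    then show False using valid_colouringsD(3)[OF c] t by simp
  qed
  ultimately show thesis by (rule that)
qed

section \<open>Dense graphs and graphs with a cycle\<close>

text \<open>The second condition on \<gamma> ensures that, for \<open>b\<close> a suitable multiple
  of \<open>n powr \<gamma>\<close>, the loss from twins is at most \<open>b\<close>; 1 \<le>
  \<gamma> absorbs the loss \<open>2 * n\<close>. The lemma serves both for a cycle in
  \<open>H\<close> and for \<open>H\<close> itself.\<close>

lemma repeat_free_number_bigo: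
  fixes \<gamma> :: real
  assumes H: "fin_graph H" "edges H \<noteq> {}"
    and W: "W \<subseteq> verts H" and E: "E \<subseteq> edges H" "E \<noteq> {}" "\<Union>E \<subseteq> W"
    and \<gamma>: "1 \<le> \<gamma>" "2 * card W - 2 \<le> card E * \<gamma>"
  shows "(\<lambda>n. real (repeat_free_number 2 n H)) \<in> O(\<lambda>n. real n powr \<gamma>)"
proof -
  have fW: "finite W" using H W by (auto simp: fin_graph_def intro: finite_subset)
  have E': "f \<subseteq> W \<and> card f = 2" if "f \<in> E" for f
    using that H E by (auto simp: fin_graph_def)
  have fE: "finite E"
    by (rule finite_subset[of _ "Pow W"]) (use E fW in auto)
  define m where "m = card E"
  have m: "m \<ge> 1" using fE E by (simp add: m_def Suc_le_eq card_gt_0_iff)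
  \<comment> \<open>With this factor \<open>4 * m * n ^ (2 * card W - 2)\<close> is at most
    \<open>b ^ m\<close>, so the last term of the counting condition is at most
    \<open>b\<close>.\<close>
  define L where "L = 4 * real m"
  have L: "L \<ge> 1" "L \<ge> 4 * real m" using m by (auto simp: L_def)
  have w: "card W \<ge> 2"
    using E' E(2) fW by (metis all_not_in_conv card_mono)
  have bound: "real (repeat_free_number 2 n H) \<le> (2 * L + 3) * real n powr \<gamma>" if n: "n \<ge> 1" for n
  proof -
    define b where "b = L * real n powr \<gamma>"
    have n1: "1 \<le> real n powr \<gamma>" and n2: "real n \<le> real n powr \<gamma>"
      using n \<gamma>(1) powr_mono[of 1 \<gamma> "real n"] by (auto simp: ge_one_powr_ge_zero)
    have b: "b > 0" unfolding b_def using L(1) n1 by (intro mult_pos_pos) linarith+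
    have "real (n ^ (2 * card W - 2)) = real n powr real (2 * card W - 2)"
      using n by (simp add: powr_realpow)
    also have "\<dots> \<le> real n powr (\<gamma> * m)"
      using n \<gamma>(2) w by (intro powr_mono) (auto simp: m_def mult.commute)
    also have "\<dots> = (real n powr \<gamma>) ^ m"
      using n by (simp add: powr_realpow[symmetric] powr_powr)
    finally have p: "real (n ^ (2 * card W - 2)) \<le> (real n powr \<gamma>) ^ m" .
    have "4 * real m * real (n ^ (2 * card W - 2)) \<le> L * (real n powr \<gamma>) ^ m"
      using L p by (intro mult_mono) auto
    also have "\<dots> \<le> L ^ m * (real n powr \<gamma>) ^ m"
      using L m power_increasing[of 1 m L] by (intro mult_right_mono) auto
    also have "\<dots> = b ^ m"
      by (simp add: b_def power_mult_distrib)
    also have "\<dots> = b * b ^ (m - 1)"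
      using m by (cases m) auto
    finally have "4 * real m * real (n ^ (2 * card W - 2)) / b ^ (m - 1) \<le> b"
      using b by (simp add: field_simps)
    \<comment> \<open>Room for \<open>b + 2 * n + b\<close>. Rounding up costs at most 1, which
      turns the factor \<open>2 * L + 2\<close> into \<open>2 * L + 3\<close>.\<close>
    moreover define C where "C = nat \<lceil>(2 * L + 2) * real n powr \<gamma>\<rceil>"
    have C: "(2 * L + 2) * real n powr \<gamma> \<le> C"
      unfolding C_def by linarith
    have "(2 * L + 2) * real n powr \<gamma> \<ge> 0" using L by simp
    then have "C \<le> (2 * L + 2) * real n powr \<gamma> + 1"
      unfolding C_def by linarith
    with n1 have C': "C \<le> (2 * L + 3) * real n powr \<gamma>"
      by (simp add: algebra_simps)
    have "b + 2 * real n + b \<le> C"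
      using C n2 by (simp add: b_def algebra_simps)
    ultimately have "b + 2 * real n + 4 * card E * n ^ (2 * card W - 2) / b ^ (card E - 1) \<le> C"
      by (simp add: m_def)
    from twin_free_colouring_exists[OF fW E' E(2) b this]
    obtain c where c: "proper_colouring (complete_graph n) C c" "\<And>\<alpha> \<beta>. \<not> twin n c W E \<alpha> \<beta>"
      by blast
    have "repeat_free_number 2 n H \<le> C"
      using c twin_mono[OF _ W E(1)] by (intro repeat_free_number_le[OF H c(1)]) blast
    then show ?thesis using C' by linarith
  qed
  show ?thesis
    by (rule bigoI[where c = "2 * L + 3"], rule eventually_mono[OF eventually_ge_at_top[of 1]])
      (use bound in auto)
qed

text \<open>Two positions giving the same edge would each be the cyclic successor of the other,
  which length at least 3 excludes.\<close>

lemma card_cycle_edges: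
  assumes "distinct xs" "3 \<le> length xs"
  shows "card ((\<lambda>i. {xs ! i, xs ! (Suc i mod length xs)}) ` {..<length xs}) = length xs"
proof -
  have "inj_on (\<lambda>i. {xs ! i, xs ! (Suc i mod length xs)}) {..<length xs}"
  proof (rule inj_onI, rule ccontr)
    fix i j assume ij: "i \<in> {..<length xs}" "j \<in> {..<length xs}"
      "{xs ! i, xs ! (Suc i mod length xs)} = {xs ! j, xs ! (Suc j mod length xs)}" "i \<noteq> j"
    have lt: "Suc i mod length xs < length xs" "Suc j mod length xs < length xs"
      using assms(2) by (auto intro: mod_less_divisor)
    have "xs ! i \<noteq> xs ! j" using ij assms by (simp add: nth_eq_iff_index_eq)
    then have "xs ! i = xs ! (Suc j mod length xs)" "xs ! j = xs ! (Suc i mod length xs)"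
      using ij(3) by (auto simp: doubleton_eq_iff)
    then have "i = Suc j mod length xs" "j = Suc i mod length xs"
      using ij lt assms by (simp_all add: nth_eq_iff_index_eq)
    moreover have "Suc k mod length xs = (if Suc k = length xs then 0 else Suc k)" if "k < length xs" for k
      using that by simp
    ultimately show False using ij(1,2) assms(2) by (auto split: if_splits)
  qed
  then show ?thesis by (simp add: card_image)
qed

lemma nonforest_bigo:
  assumes H: "fin_graph H" "edges H \<noteq> {}" and nf: "\<not> forest H"
  obtains \<epsilon> :: real where "\<epsilon> > 0" "(\<lambda>n. real (repeat_free_number 2 n H)) \<in> O(\<lambda>n. real n powr (2 - \<epsilon>))"
proof -
  obtain xs where xs: "is_cycle H xs" using nf by (auto simp: forest_def)
  define l where "l = length xs"
  define E where "E = (\<lambda>i. {xs ! i, xs ! (Suc i mod l)}) ` {..<l}"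
  have l: "3 \<le> l" "distinct xs" and EH: "E \<subseteq> edges H"
    using xs by (auto simp: is_cycle_def l_def E_def)
  have cE: "card E = l" unfolding E_def l_def
    by (rule card_cycle_edges) (use l in \<open>auto simp: l_def\<close>)
  have EW: "\<Union>E \<subseteq> set xs"
    using l by (auto simp: E_def l_def intro!: nth_mem mod_less_divisor)
  have WH: "set xs \<subseteq> verts H"
  proof
    fix x assume "x \<in> set xs"
    then obtain i where "i < l" "x = xs ! i" by (auto simp: in_set_conv_nth l_def)
    then have "x \<in> \<Union>E" by (auto simp: E_def)
    then show "x \<in> verts H" using EH H by (auto simp: fin_graph_def)
  qed
  have E0: "E \<noteq> {}" using cE l by auto
  have cW: "card (set xs) = l" using l by (simp add: l_def distinct_card)
  \<comment> \<open>A cycle has as many edges as vertices, so the condition reads 2 l - 2 \<le> l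
    \<gamma>, with equality for \<gamma> = 2 - 2 / l.\<close>
  have "(\<lambda>n. real (repeat_free_number 2 n H)) \<in> O(\<lambda>n. real n powr (2 - 2 / l))"
    by (rule repeat_free_number_bigo[OF H WH EH E0 EW])
      (use l in \<open>auto simp: cE cW field_simps\<close>)
  then show ?thesis using l by (intro that[of "2 / l"]) auto
qed

text \<open>The density hypothesis is the condition of the counting bound for \<gamma> = 1; the
  lower bound comes from the star at a vertex.\<close>

lemma dense_bigtheta:
  assumes H: "fin_graph H" "edges H \<noteq> {}"
    and dense: "int (card (edges H)) \<ge> 2 * int (card (verts H)) - 2"
  shows "(\<lambda>n. real (repeat_free_number 2 n H)) \<in> \<Theta>(\<lambda>n. real n)"
proof (rule bigthetaI)
  have "(\<lambda>n. real (repeat_free_number 2 n H)) \<in> O(\<lambda>n. real n powr 1)"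
    using dense H by (intro repeat_free_number_bigo[OF H order.refl order.refl]) (auto simp: fin_graph_def)
  then show "(\<lambda>n. real (repeat_free_number 2 n H)) \<in> O(\<lambda>n. real n)" by simp
  have "real n \<le> 2 * real (repeat_free_number 2 n H)" if "n \<ge> 2" for n
    using repeat_free_number_ge[OF H, of n] that by linarith
  then show "(\<lambda>n. real (repeat_free_number 2 n H)) \<in> \<Omega>(\<lambda>n. real n)"
    unfolding bigomega_iff_bigo
    by (intro bigoI[where c = 2] eventually_mono[OF eventually_ge_at_top[of 2]]) auto
qed

section \<open>The pair graph and forests\<close>

text \<open>
  The vertices stand for pairs of points of the complete graph, \<open>pts\<close> being the underlying set.
  Properness of the colouring is what gives \<open>hit\<close> and \<open>max_deg\<close>.
\<close>
locale pair_graph =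
  fixes V :: "'v set" and R :: "'v \<Rightarrow> 'v \<Rightarrow> bool" and pts :: "'v \<Rightarrow> nat set" and n :: nat and D :: real
  assumes fin: "finite V" and sym: "R x y \<Longrightarrow> R y x"
    and disj: "R x y \<Longrightarrow> pts x \<inter> pts y = {}"
    and pts: "finite (pts x)" "card (pts x) \<le> 2"
    and hit: "x \<in> V \<Longrightarrow> card {y \<in> V. R x y \<and> w \<in> pts y} \<le> 2"
    and max_deg: "x \<in> V \<Longrightarrow> card {y \<in> V. R x y} \<le> n"
    and min_deg: "x \<in> V \<Longrightarrow> D \<le> card {y \<in> V. R x y}"
begin

lemma hit_set:
  assumes "x \<in> V" "finite Z"
  shows "card {y \<in> V. R x y \<and> pts y \<inter> Z \<noteq> {}} \<le> 2 * card Z"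
proof -
  have "{y \<in> V. R x y \<and> pts y \<inter> Z \<noteq> {}} = (\<Union>w\<in>Z. {y \<in> V. R x y \<and> w \<in> pts y})" by auto
  then have "card {y \<in> V. R x y \<and> pts y \<inter> Z \<noteq> {}} \<le> (\<Sum>w\<in>Z. card {y \<in> V. R x y \<and> w \<in> pts y})"
    using card_UN_le[OF assms(2)] by simp
  also have "\<dots> \<le> (\<Sum>w\<in>Z. 2)"
    using hit[OF assms(1)] by (intro sum_mono) auto
  finally show ?thesis by simp
qed

text \<open>The greedy step of the embeddings below: each forbidden point excludes at most two
  neighbours. The filter \<open>Q\<close> allows a choice among common neighbours.\<close>

lemma pick_neighbour:
  assumes x: "x \<in> V" and Z: "finite Z" and many: "2 * card Z < card {y \<in> V. R x y \<and> Q y}"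
  obtains y where "y \<in> V" "R x y" "Q y" "pts y \<inter> Z = {}"
proof -
  have "\<not> {y \<in> V. R x y \<and> Q y} \<subseteq> {y \<in> V. R x y \<and> pts y \<inter> Z \<noteq> {}}"
  proof
    assume "{y \<in> V. R x y \<and> Q y} \<subseteq> {y \<in> V. R x y \<and> pts y \<inter> Z \<noteq> {}}"
    then have "card {y \<in> V. R x y \<and> Q y} \<le> card {y \<in> V. R x y \<and> pts y \<inter> Z \<noteq> {}}"
      using fin by (intro card_mono) auto
    then show False using hit_set[OF x Z] many by linarith
  qed
  then show thesis using that by blast
qed

text \<open>Disjointness is required of all distinct vertices, adjacent or not; for pairs of
  distinct points this turns the two coordinates into vertex-disjoint copies.\<close>

definition embeds :: "'a set \<Rightarrow> 'a set set \<Rightarrow> ('a \<Rightarrow> 'v) \<Rightarrow> bool" where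
  "embeds W E \<theta> \<longleftrightarrow> \<theta> ` W \<subseteq> V \<and> (\<forall>x \<in> W. \<forall>y \<in> W. {x, y} \<in> E \<longrightarrow> R (\<theta> x) (\<theta> y)) \<and>
     (\<forall>x \<in> W. \<forall>y \<in> W. x \<noteq> y \<longrightarrow> pts (\<theta> x) \<inter> pts (\<theta> y) = {})"

lemma embedsD:
  assumes "embeds W E \<theta>"
  shows "x \<in> W \<Longrightarrow> \<theta> x \<in> V"
    and "x \<in> W \<Longrightarrow> y \<in> W \<Longrightarrow> {x, y} \<in> E \<Longrightarrow> R (\<theta> x) (\<theta> y)"
    and "x \<in> W \<Longrightarrow> y \<in> W \<Longrightarrow> x \<noteq> y \<Longrightarrow> pts (\<theta> x) \<inter> pts (\<theta> y) = {}"
  using assms unfolding embeds_def by blast+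

lemma embeds_extend:
  assumes th: "embeds W {e \<in> E. x \<notin> e} \<theta>" and x: "x \<notin> W" and y: "y \<in> V"
    and dj: "\<And>z. z \<in> W \<Longrightarrow> pts y \<inter> pts (\<theta> z) = {}"
    and adj: "\<And>z. z \<in> W \<Longrightarrow> {x, z} \<in> E \<Longrightarrow> R y (\<theta> z)" and loop: "{x, x} \<notin> E"
  shows "embeds (insert x W) E (\<theta>(x := y))"
  unfolding embeds_def
proof (intro conjI ballI impI)
  show "(\<theta>(x := y)) ` insert x W \<subseteq> V"
    using y x embedsD(1)[OF th] by auto
  fix a b assume ab: "a \<in> insert x W" "b \<in> insert x W"
  consider "a = x" "b = x" | "a = x" "b \<in> W" "b \<noteq> x" | "a \<in> W" "a \<noteq> x" "b = x"
    | "a \<in> W" "a \<noteq> x" "b \<in> W" "b \<noteq> x"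
    using ab x by blast
  note cs = this
  show "R ((\<theta>(x := y)) a) ((\<theta>(x := y)) b)" if e: "{a, b} \<in> E"
    using cs
  proof cases
    case 1
    then show ?thesis using e loop by simp
  next
    case 2
    then show ?thesis using adj[of b] e by simp
  next
    case 3
    then have "R y (\<theta> a)" using adj[of a] e by (simp add: insert_commute)
    then show ?thesis using 3 sym[of y "\<theta> a"] by simp
  next
    case 4
    then show ?thesis using embedsD(2)[OF th, of a b] e by simp
  qed
  show "pts ((\<theta>(x := y)) a) \<inter> pts ((\<theta>(x := y)) b) = {}" if "a \<noteq> b"
    using cs
  proof cases
    case 3
    then show ?thesis using dj[of a] by (simp add: Int_commute)
  qed (use that dj[of b] embedsD(3)[OF th, of a b] in simp_all)
qed

end

text \<open>Consider the first vertex of a longest path. A neighbour other than its successor lies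
  on the path, by maximality, and closes a cycle. Isolated vertices also qualify, with any
  \<open>p\<close>.\<close>

lemma forest_has_leaf:
  assumes H: "fin_graph H" and f: "forest H" and ne: "verts H \<noteq> {}"
  obtains x p where "x \<in> verts H" "\<And>y. {x, y} \<in> edges H \<Longrightarrow> y = p"
proof (rule ccontr)
  assume "\<not> thesis"
  then have two: "\<exists>y. {x, y} \<in> edges H \<and> y \<noteq> p" if "x \<in> verts H" for x p
    using that \<open>\<not> thesis\<close> assms that by (metis \<open>\<And>x p. x \<in> verts H \<Longrightarrow> (\<And>y. {x, y} \<in> edges H \<Longrightarrow> y = p) \<Longrightarrow> thesis\<close>)
  define path where "path xs \<longleftrightarrow> xs \<noteq> [] \<and> distinct xs \<and> set xs \<subseteq> verts H \<and>
    (\<forall>i. Suc i < length xs \<longrightarrow> {xs ! i, xs ! Suc i} \<in> edges H)" for xs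
  obtain v where "v \<in> verts H" using ne by blast
  then have p0: "path [v]" by (simp add: path_def)
  have fV: "finite (verts H)" using H by (simp add: fin_graph_def)
  have "length xs < Suc (card (verts H))" if "path xs" for xs
    using that card_mono[OF fV, of "set xs"] by (simp add: path_def distinct_card)
  then obtain xs where xs: "path xs" and mx: "\<And>ys. path ys \<Longrightarrow> length ys \<le> length xs"
    using ex_has_greatest_nat[of path "[v]" length "Suc (card (verts H))"] p0 by blast
  \<comment> \<open>The neighbour to be avoided. A one-vertex path has no second vertex, and its
    only vertex serves as default.\<close>
  define q where "q = (if length xs > 1 then xs ! 1 else xs ! 0)"
  have x0: "xs ! 0 \<in> verts H" using xs by (auto simp: path_def)
  obtain y where y: "{xs ! 0, y} \<in> edges H" "y \<noteq> q" using two[OF x0, of q] by blast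
  have "y \<in> verts H" "y \<noteq> xs ! 0"
    using H y(1) by (force simp: fin_graph_def)+
  have "y \<in> set xs"
  proof (rule ccontr)
    assume "y \<notin> set xs"
    then have "path (y # xs)"
      using xs y \<open>y \<in> verts H\<close> by (auto simp: path_def nth_Cons insert_commute split: nat.splits)
    then show False using mx by fastforce
  qed
  then obtain j where j: "j < length xs" "xs ! j = y" by (auto simp: in_set_conv_nth)
  have "j \<noteq> 0" "j \<noteq> 1"
    using j y \<open>y \<noteq> xs ! 0\<close> by (auto simp: q_def intro: gr0I)
  then have j2: "2 \<le> j" by simp
  have "is_cycle H (take (Suc j) xs)"
    unfolding is_cycle_def
  proof (intro conjI allI impI)
    have len: "length (take (Suc j) xs) = Suc j" using j by simp
    show "3 \<le> length (take (Suc j) xs)" using len j2 by simp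
    show "distinct (take (Suc j) xs)" using xs by (simp add: path_def)
    fix i assume "i < length (take (Suc j) xs)"
    then have i: "i \<le> j" using len by simp
    show "{take (Suc j) xs ! i, take (Suc j) xs ! (Suc i mod length (take (Suc j) xs))} \<in> edges H"
    proof (cases "i = j")
      case True
      then show ?thesis using y j len by (simp add: insert_commute)
    next
      case False
      then show ?thesis using i xs j len by (simp add: path_def)
    qed
  qed
  then show False using f by (auto simp: forest_def)
qed

lemma forest_delete_vertex:
  assumes "fin_graph H" "forest H"
  shows "fin_graph \<lparr>verts = verts H - {x}, edges = {e \<in> edges H. x \<notin> e}\<rparr>"
    and "forest \<lparr>verts = verts H - {x}, edges = {e \<in> edges H. x \<notin> e}\<rparr>"
proof -
  let ?H = "\<lparr>verts = verts H - {x}, edges = {e \<in> edges H. x \<notin> e}\<rparr>"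
  show "fin_graph ?H" using assms(1) by (auto simp: fin_graph_def)
  have "is_cycle H xs" if "is_cycle ?H xs" for xs
    using that unfolding is_cycle_def by simp
  then show "forest ?H" using assms(2) unfolding forest_def by blast
qed

text \<open>A leaf \<open>x\<close> is removed, the rest embedded, and \<open>x\<close> placed on a
  fresh neighbour of the image of \<open>p\<close>. Every earlier vertex occupies at most two points
  and each point excludes at most two neighbours, hence the constant 4.\<close>

lemma (in pair_graph) forest_embeds:
  assumes "fin_graph H" "forest H" and V: "V \<noteq> {}" and "4 * card (verts H) < D"
  shows "\<exists>\<theta>. embeds (verts H) (edges H) \<theta>"
  using assms
proof (induction "card (verts H)" arbitrary: H)
  case 0
  then have "verts H = {}" by (simp add: fin_graph_def)
  then show ?case by (auto simp: embeds_def)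
next
  case (Suc k)
  have fV: "finite (verts H)" using Suc.prems by (simp add: fin_graph_def)
  have "verts H \<noteq> {}" using Suc.hyps by auto
  from forest_has_leaf[OF Suc.prems(1,2) this]
  obtain x p where x: "x \<in> verts H" and p: "\<And>y. {x, y} \<in> edges H \<Longrightarrow> y = p" by blast
  define W where "W = verts H - {x}"
  define H' where "H' = \<lparr>verts = W, edges = {e \<in> edges H. x \<notin> e}\<rparr>"
  have W: "verts H = insert x W" "x \<notin> W" "card W = k" "finite W"
    using x fV Suc.hyps by (auto simp: W_def)
  have "\<exists>\<theta>. embeds (verts H') (edges H') \<theta>"
  proof (rule Suc.hyps(1)[OF _ _ _ V])
    show "k = card (verts H')" using W by (simp add: H'_def)
    show "fin_graph H'" "forest H'"
      unfolding H'_def W_def by (rule forest_delete_vertex[OF Suc.prems(1,2)])+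
    show "4 * card (verts H') < D" using Suc.prems(4) W by (simp add: H'_def)
  qed
  then obtain \<theta> where th: "embeds W {e \<in> edges H. x \<notin> e} \<theta>" by (auto simp: H'_def)
  define Z where "Z = (\<Union>z\<in>W. pts (\<theta> z))"
  have fZ: "finite Z" using W pts by (simp add: Z_def)
  have "card Z \<le> (\<Sum>z\<in>W. card (pts (\<theta> z)))"
    unfolding Z_def by (rule card_UN_le[OF W(4)])
  also have "\<dots> \<le> (\<Sum>z\<in>W. 2)" using pts by (intro sum_mono)
  finally have cZ: "card Z \<le> 2 * k" using W by simp
  \<comment> \<open>If \<open>x\<close> is isolated, \<open>p\<close> may lie outside
    \<open>W\<close>, and then any vertex of \<open>V\<close> serves as \<open>v\<close>.\<close>
  obtain v where v: "v \<in> V" "p \<in> W \<Longrightarrow> v = \<theta> p"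
    using V embedsD(1)[OF th, of p] by (cases "p \<in> W") auto
  have "2 * card Z < card {y \<in> V. R v y \<and> True}"
    using min_deg[OF v(1)] Suc.prems(4) cZ W by simp
  from pick_neighbour[OF v(1) fZ this]
  obtain y where y: "y \<in> V" "R v y" "pts y \<inter> Z = {}" by blast
  have "embeds (insert x W) (edges H) (\<theta>(x := y))"
  proof (rule embeds_extend[OF th W(2) y(1)])
    show "pts y \<inter> pts (\<theta> z) = {}" if "z \<in> W" for z
      using y(3) that by (auto simp: Z_def)
    show "R y (\<theta> z)" if "z \<in> W" "{x, z} \<in> edges H" for z
      using p[OF that(2)] v(2) y(2) sym that by simp
    show "{x, x} \<notin> edges H" using Suc.prems(1) by (force simp: fin_graph_def)
  qed
  then show ?case using W by auto
qed

section \<open>From a proper colouring to a pair graph of large minimum degree\<close>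

lemma min_degree_subgraph:
  fixes D :: real
  assumes fin: "finite V0" and ne: "V0 \<noteq> {}" and sym: "\<And>x y. R x y \<Longrightarrow> R y x" and irr: "\<And>x. \<not> R x x"
    and D: "D > 0" and dense: "2 * D * card V0 \<le> card {(x, y) \<in> V0 \<times> V0. R x y}"
  obtains V where "V \<subseteq> V0" "V \<noteq> {}" "\<And>x. x \<in> V \<Longrightarrow> D \<le> card {y \<in> V. R x y}"
proof -
  \<comment> \<open>A smallest set of average degree at least \<open>2 * D\<close> is taken.
    Deleting a vertex of degree below \<open>D\<close> would remove fewer than \<open>2 * D\<close>
    ordered pairs and so keep the density, against minimality.\<close>
  define good where "good V \<longleftrightarrow> V \<subseteq> V0 \<and> V \<noteq> {} \<and> 2 * D * card V \<le> card {(x, y) \<in> V \<times> V. R x y}" for V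
  have "good V0" using ne dense by (simp add: good_def)
  then obtain V where V: "good V" and mn: "\<And>U. good U \<Longrightarrow> card V \<le> card U"
    using ex_has_least_nat[of good V0 card] by blast
  have fV: "finite V" using V fin by (auto simp: good_def intro: finite_subset)
  have "D \<le> card {y \<in> V. R x y}" if x: "x \<in> V" for x
  proof (rule ccontr)
    assume small: "\<not> D \<le> card {y \<in> V. R x y}"
    let ?e = "\<lambda>V. {(x, y) \<in> V \<times> V. R x y}"
    define U where "U = V - {x}"
    have cV: "card V = Suc (card U)" using x fV unfolding U_def by (metis card_Suc_Diff1)
    have "?e V \<subseteq> ?e U \<union> Pair x ` {y \<in> V. R x y} \<union> (\<lambda>y. (y, x)) ` {y \<in> V. R x y}"
      using sym by (auto simp: U_def)
    then have "card (?e V) \<le> card (?e U \<union> Pair x ` {y \<in> V. R x y} \<union> (\<lambda>y. (y, x)) ` {y \<in> V. R x y})"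
      using fV by (intro card_mono) (auto simp: U_def intro: finite_subset[of _ "V \<times> V"])
    also have "\<dots> \<le> card (?e U) + card (Pair x ` {y \<in> V. R x y}) + card ((\<lambda>y. (y, x)) ` {y \<in> V. R x y})"
      by (meson add_mono card_Un_le order_refl order_trans)
    also have "\<dots> \<le> card (?e U) + card {y \<in> V. R x y} + card {y \<in> V. R x y}"
      using fV by (intro add_mono card_image_le) auto
    finally have "real (card (?e V)) \<le> card (?e U) + 2 * card {y \<in> V. R x y}" by linarith
    moreover have big: "2 * D * card V \<le> card (?e V)" using V by (simp add: good_def)
    ultimately have eU: "2 * D * card U \<le> card (?e U)"
      using small by (simp add: cV algebra_simps)
    \<comment> \<open>If nothing is left after the deletion, \<open>V\<close> is a single vertex,
      which without loops has no adjacent pairs and violates the density.\<close>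
    show False
    proof (cases "U = {}")
      case True
      then have "V = {x}" using x by (auto simp: U_def)
      then have "?e V = {}" using irr by auto
      then have "card (?e V) = 0" by (simp only: card.empty)
      moreover have "card V = 1" using \<open>V = {x}\<close> by simp
      ultimately show False using big D by simp
    next
      case False
      then have "good U" using eU V by (auto simp: good_def U_def)
      then show False using mn[of U] cV by simp
    qed
  qed
  then show thesis using V by (intro that[of V]) (auto simp: good_def)
qed

text \<open>A pair collects the images of one vertex under the two embeddings of a twin. An edge of
  \<open>H\<close> then becomes two equally coloured edges, one between the first and one between
  the second coordinates.\<close>

definition colour_adj :: "(nat set \<Rightarrow> nat) \<Rightarrow> nat \<times> nat \<Rightarrow> nat \<times> nat \<Rightarrow> bool" where
  "colour_adj c x y \<longleftrightarrow> distinct [fst x, snd x, fst y, snd y] \<and> c {fst x, fst y} = c {snd x, snd y}"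

definition point_pairs :: "nat \<Rightarrow> (nat \<times> nat) set" where
  "point_pairs n = {(u, v). u < n \<and> v < n \<and> u \<noteq> v}"

lemma point_pairs_card: "finite (point_pairs n)" "card (point_pairs n) = n * (n - 1)"
proof -
  have "point_pairs n = (SIGMA u:{..<n}. {..<n} - {u})" by (auto simp: point_pairs_def)
  then show "finite (point_pairs n)" "card (point_pairs n) = n * (n - 1)" by auto
qed

text \<open>The set \<open>point_pairs n\<close> is read in two ways: as oriented edges, where
  Cauchy-Schwarz over the colour classes yields many equally coloured pairs, and as vertices of the
  pair graph, into which these pairs are regrouped.\<close>

lemma colour_adj_count:
  assumes c: "proper_colouring (complete_graph n) C c" and C: "C > 0"
  shows "real (card (point_pairs n)) ^ 2 / C - 2 * card (point_pairs n)
    \<le> card {(x, y) \<in> point_pairs n \<times> point_pairs n. colour_adj c x y}"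
proof -
  let ?A = "point_pairs n"
  define g where "g a = c {fst a, snd a}" for a :: "nat \<times> nat"
  define Q where "Q = {(a, b) \<in> ?A \<times> ?A. g a = g b}"
  define F where "F k = {a \<in> ?A. g a = k}" for k
  define S where "S = {(a, b) \<in> ?A \<times> ?A. {fst a, snd a} = {fst b, snd b}}"
  define T where "T = {(x, y) \<in> ?A \<times> ?A. colour_adj c x y}"
  have fA: "finite ?A" by (rule point_pairs_card)
  have gC: "g a < C" if "a \<in> ?A" for a
  proof -
    have "{fst a, snd a} \<in> edges (complete_graph n)" using that by (auto simp: point_pairs_def)
    then show ?thesis using c unfolding proper_colouring_def g_def by blast
  qed
  have "?A = (\<Union>k\<in>{..<C}. F k)" using gC by (auto simp: F_def)
  then have "card ?A = card (\<Union>k\<in>{..<C}. F k)" by simp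
  also have "\<dots> = (\<Sum>k<C. card (F k))"
    using fA by (intro card_UN_disjoint) (auto simp: F_def)
  finally have cA: "real (card ?A) = (\<Sum>k<C. real (card (F k)))" by simp
  have "Q = (\<Union>k\<in>{..<C}. F k \<times> F k)" using gC by (auto simp: F_def Q_def)
  then have "card Q = card (\<Union>k\<in>{..<C}. F k \<times> F k)" by simp
  also have "\<dots> = (\<Sum>k<C. card (F k \<times> F k))"
    using fA by (intro card_UN_disjoint) (auto simp: F_def)
  finally have cQ: "real (card Q) = (\<Sum>k<C. real (card (F k)) ^ 2)"
    by (simp add: card_cartesian_product power2_eq_square)
  have "real (card ?A) ^ 2 \<le> C * real (card Q)"
    unfolding cA cQ using sum_squared_le_sum_of_squares[of "\<lambda>k. real (card (F k))" "{..<C}"] by (simp add: mult.commute)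
  then have q: "real (card ?A) ^ 2 / C \<le> card Q" using C by (simp add: field_simps)
  \<comment> \<open>An oriented edge shares its underlying edge only with itself and its reversal;
    this is the subtracted term.\<close>
  have "S \<subseteq> (\<lambda>a. (a, a)) ` ?A \<union> (\<lambda>a. (a, prod.swap a)) ` ?A"
    by (auto simp: S_def doubleton_eq_iff image_iff)
  then have "card S \<le> card ((\<lambda>a. (a, a)) ` ?A \<union> (\<lambda>a. (a, prod.swap a)) ` ?A)"
    using fA by (intro card_mono) auto
  also have "\<dots> \<le> card ((\<lambda>a. (a, a)) ` ?A) + card ((\<lambda>a. (a, prod.swap a)) ` ?A)"
    by (rule card_Un_le)
  also have "\<dots> \<le> card ?A + card ?A"
    using fA by (intro add_mono card_image_le)
  finally have s: "card S \<le> 2 * card ?A" by simp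
  have fS: "finite S" "finite Q" "finite T"
    by (rule finite_subset[of _ "?A \<times> ?A"]; use fA in \<open>auto simp: S_def Q_def T_def\<close>)+
  \<comment> \<open>Two oriented edges \<open>(u, v)\<close> and \<open>(u', v')\<close> of one
    colour become the adjacent pairs \<open>(u, u')\<close> and \<open>(v, v')\<close>. Properness
    makes distinct edges of one colour disjoint, so the four points are distinct.\<close>
  define h :: "(nat \<times> nat) \<times> (nat \<times> nat) \<Rightarrow> _" where
    "h p = ((fst (fst p), fst (snd p)), (snd (fst p), snd (snd p)))" for p
  have "h ` (Q - S) \<subseteq> T"
  proof
    fix z assume "z \<in> h ` (Q - S)"
    then obtain p where p: "p \<in> Q - S" "z = h p" by blast
    obtain u v u' v' where "p = ((u, v), (u', v'))" by (metis surj_pair)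
    with p have z: "z = ((u, u'), (v, v'))" and q: "((u, v), (u', v')) \<in> Q"
      and s: "((u, v), (u', v')) \<notin> S"
      by (simp_all add: h_def)
    have lt: "u < n" "v < n" "u \<noteq> v" "u' < n" "v' < n" "u' \<noteq> v'" and eq: "c {u, v} = c {u', v'}"
      using q by (auto simp: Q_def point_pairs_def g_def)
    have "{u, v} \<noteq> {u', v'}" using s q by (auto simp: S_def Q_def)
    then have "{u, v} \<inter> {u', v'} = {}"
      using c eq lt unfolding proper_colouring_def by (meson doubleton_in_complete_graph)
    then show "z \<in> T"
      using z lt eq by (auto simp: T_def point_pairs_def colour_adj_def)
  qed
  moreover have "inj_on h (Q - S)" by (auto simp: inj_on_def h_def)
  ultimately have "card (Q - S) \<le> card T" using fS by (intro card_inj_on_le)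
  moreover have "card Q - card S \<le> card (Q - S)" using fS by (intro diff_card_le_card_Diff)
  ultimately have "real (card Q) - 2 * card ?A \<le> card T" using s by linarith
  then show ?thesis using q by (simp add: T_def)
qed

text \<open>The average degree is at least \<open>n * (n - 1) / C - 2\<close>, and passing to a
  subset of large minimum degree halves it; hence \<open>2 * D + 2\<close>.\<close>

lemma pair_graph_core:
  assumes c: "proper_colouring (complete_graph n) C c" and C: "C > 0" and n: "n \<ge> 2"
    and D: "0 < D" "2 * D + 2 \<le> real n * (real n - 1) / C"
  obtains V where "V \<noteq> {}" "V \<subseteq> point_pairs n"
    "pair_graph V (colour_adj c) (\<lambda>x. {fst x, snd x}) n D"
proof -
  let ?A = "point_pairs n"
  have sym: "colour_adj c x y \<Longrightarrow> colour_adj c y x" for x y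
    unfolding colour_adj_def by (auto simp: insert_commute)
  have A: "real (card ?A) = real n * (real n - 1)" using n by (simp add: point_pairs_card)
  have "(2 * D + 2) * card ?A \<le> real (card ?A) / C * card ?A"
    using D(2)[folded A] by (intro mult_right_mono) auto
  then have "2 * D * card ?A \<le> real (card ?A) ^ 2 / C - 2 * card ?A"
    by (simp add: algebra_simps power2_eq_square)
  also have "\<dots> \<le> card {(x, y) \<in> ?A \<times> ?A. colour_adj c x y}"
    by (rule colour_adj_count[OF c C])
  finally have dense: "2 * D * card ?A \<le> card {(x, y) \<in> ?A \<times> ?A. colour_adj c x y}" .
  have "(0, 1) \<in> ?A" using n by (simp add: point_pairs_def)
  then have "?A \<noteq> {}" by blast
  from min_degree_subgraph[OF point_pairs_card(1) this sym _ D(1) dense]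
  obtain V where V: "V \<subseteq> ?A" "V \<noteq> {}" "\<And>x. x \<in> V \<Longrightarrow> D \<le> card {y \<in> V. colour_adj c x y}"
    by (auto simp: colour_adj_def)
  have fV: "finite V" using V(1) point_pairs_card(1) by (rule finite_subset)
  have inj: "x = y" if "a < n" "x < n" "y < n" "x \<noteq> a" "y \<noteq> a" "c {a, x} = c {a, y}" for a x y
  proof (rule ccontr)
    assume "x \<noteq> y"
    then have "{a, x} \<noteq> {a, y}" by (auto simp: doubleton_eq_iff)
    moreover have "{a, x} \<inter> {a, y} \<noteq> {}" by blast
    moreover have "{a, x} \<in> edges (complete_graph n)" "{a, y} \<in> edges (complete_graph n)"
      using that by auto
    ultimately show False using c that(6) unfolding proper_colouring_def by metis
  qed
  have VP: "fst x < n" "snd x < n" if "x \<in> V" for x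
    using subsetD[OF V(1) that] by (simp_all add: point_pairs_def case_prod_beta)
  \<comment> \<open>The first coordinate of a neighbour of \<open>x\<close> fixes the colour of the
    edge to it, and properness at \<open>snd x\<close> then fixes the second coordinate. So there
    are at most \<open>n\<close> neighbours, and at most one with a given point in a given
    coordinate.\<close>
  have fst_eq: "y = z" if "x \<in> V" "y \<in> V" "z \<in> V" "colour_adj c x y" "colour_adj c x z" "fst y = fst z" for x y z
  proof -
    have "snd y = snd z"
    proof (rule inj)
      show "c {snd x, snd y} = c {snd x, snd z}"
        using that(4-6) by (simp add: colour_adj_def)
      show "snd y \<noteq> snd x" "snd z \<noteq> snd x"
        using that(4,5) by (auto simp: colour_adj_def)
    qed (simp_all add: VP that(1-3))
    then show ?thesis using that(6) by (intro prod_eqI)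
  qed
  have snd_eq: "y = z" if "x \<in> V" "y \<in> V" "z \<in> V" "colour_adj c x y" "colour_adj c x z" "snd y = snd z" for x y z
  proof -
    have "fst y = fst z"
    proof (rule inj)
      show "c {fst x, fst y} = c {fst x, fst z}"
        using that(4-6) by (simp add: colour_adj_def)
      show "fst y \<noteq> fst x" "fst z \<noteq> fst x"
        using that(4,5) by (auto simp: colour_adj_def)
    qed (simp_all add: VP that(1-3))
    then show ?thesis using that(6) by (intro prod_eqI)
  qed
  have "pair_graph V (colour_adj c) (\<lambda>x. {fst x, snd x}) n D"
  proof
    show "finite V" by fact
    show "colour_adj c y x" if "colour_adj c x y" for x y using sym that .
    show "{fst x, snd x} \<inter> {fst y, snd y} = {}" if "colour_adj c x y" for x y
      using that by (auto simp: colour_adj_def)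
    show "finite {fst x, snd x}" "card {fst x, snd x} \<le> 2" for x :: "nat \<times> nat"
      by (auto simp: card_insert_if)
    show "D \<le> card {y \<in> V. colour_adj c x y}" if "x \<in> V" for x using V(3) that .
    show "card {y \<in> V. colour_adj c x y} \<le> n" if x: "x \<in> V" for x
    proof -
      have "card {y \<in> V. colour_adj c x y} \<le> card {..<n}"
      proof (rule card_inj_on_le[of fst])
        show "inj_on fst {y \<in> V. colour_adj c x y}"
          using fst_eq[OF x] by (auto intro!: inj_onI)
      qed (use VP in auto)
      then show ?thesis by simp
    qed
    show "card {y \<in> V. colour_adj c x y \<and> w \<in> {fst y, snd y}} \<le> 2" if x: "x \<in> V" for x w
    proof -
      let ?B = "{y \<in> V. colour_adj c x y \<and> fst y = w}" and ?B' = "{y \<in> V. colour_adj c x y \<and> snd y = w}"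
      have "card ?B \<le> Suc 0" "card ?B' \<le> Suc 0"
        using fst_eq[OF x] snd_eq[OF x] fV by (auto simp: card_le_Suc0_iff_eq)
      moreover have "{y \<in> V. colour_adj c x y \<and> w \<in> {fst y, snd y}} = ?B \<union> ?B'" by auto
      ultimately show ?thesis using card_Un_le[of ?B ?B'] by simp
    qed
  qed
  then show thesis using V by (intro that[of V])
qed

text \<open>The first coordinates of the images form one copy, the second coordinates the
  other.\<close>

lemma twin_of_embeds:
  assumes "pair_graph V (colour_adj c) (\<lambda>x. {fst x, snd x}) n D" and V: "V \<subseteq> point_pairs n"
    and E: "\<And>e. e \<in> E \<Longrightarrow> \<exists>x y. e = {x, y} \<and> x \<in> W \<and> y \<in> W"
    and th: "pair_graph.embeds V (colour_adj c) (\<lambda>x. {fst x, snd x}) W E \<theta>"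
  shows "twin n c W E (fst \<circ> \<theta>) (snd \<circ> \<theta>)"
proof -
  interpret pair_graph V "colour_adj c" "\<lambda>x. {fst x, snd x}" n D by fact
  have dj: "fst (\<theta> x) \<noteq> fst (\<theta> y) \<and> snd (\<theta> x) \<noteq> snd (\<theta> y) \<and> fst (\<theta> x) \<noteq> snd (\<theta> y)"
    if "x \<in> W" "y \<in> W" "x \<noteq> y" for x y
    using embedsD(3)[OF th that] by auto
  have pp: "fst (\<theta> x) < n \<and> snd (\<theta> x) < n \<and> fst (\<theta> x) \<noteq> snd (\<theta> x)" if "x \<in> W" for x
    using subsetD[OF V embedsD(1)[OF th that]] by (simp add: point_pairs_def case_prod_beta)
  have "fst (\<theta> x) \<noteq> snd (\<theta> y)" if "x \<in> W" "y \<in> W" for x y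
    using dj[OF that] pp[OF that(1)] by (cases "x = y") auto
  moreover have "c ((fst \<circ> \<theta>) ` e) = c ((snd \<circ> \<theta>) ` e)" if e: "e \<in> E" for e
  proof -
    obtain x y where "e = {x, y}" "x \<in> W" "y \<in> W" using E[OF e] by blast
    then show ?thesis using embedsD(2)[OF th, of x y] e by (simp add: colour_adj_def)
  qed
  moreover have "inj_on (fst \<circ> \<theta>) W" "inj_on (snd \<circ> \<theta>) W"
    using dj by (auto simp: inj_on_def)
  ultimately show ?thesis
    using pp unfolding twin_def by (auto simp: disjoint_iff)
qed

lemma forest_bigtheta:
  assumes H: "fin_graph H" "edges H \<noteq> {}" and f: "forest H"
  shows "(\<lambda>n. real (repeat_free_number 2 n H)) \<in> \<Theta>(\<lambda>n. real n ^ 2)"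
proof (rule bigthetaI)
  have "real (repeat_free_number 2 n H) \<le> real n ^ 2" for n
    using repeat_free_number_le_square[OF H, of n] by (metis of_nat_le_iff of_nat_power)
  then show "(\<lambda>n. real (repeat_free_number 2 n H)) \<in> O(\<lambda>n. real n ^ 2)"
    by (intro bigoI[where c = 1]) auto
  define w where "w = real (card (verts H))"
  \<comment> \<open>The argument gives \<open>n * (n - 1) < (8 * w + 4) * C\<close>, and
    \<open>n ^ 2\<close> is at most twice the left side; \<open>K\<close> dominates the resulting
    factor \<open>2 * (8 * w + 4)\<close>.\<close>
  define K where "K = 4 * (5 * w + 2)"
  have "real n ^ 2 \<le> K * real (repeat_free_number 2 n H)" if n: "n \<ge> 2" for n
  proof -
    define C where "C = repeat_free_number 2 n H"
    obtain c where c: "proper_colouring (complete_graph n) C c"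
      and nt: "\<And>\<alpha> \<beta>. \<not> twin n c (verts H) (edges H) \<alpha> \<beta>"
      using repeat_free_number_colouring[OF H] unfolding C_def by metis
    have C: "C > 0" using repeat_free_number_ge[OF H, of n] n by (simp add: C_def)
    have "real n * (real n - 1) / C < 2 * (4 * w + 1) + 2"
    proof (rule ccontr)
      assume big: "\<not> real n * (real n - 1) / C < 2 * (4 * w + 1) + 2"
      \<comment> \<open>The minimum degree \<open>4 * w + 1\<close> is just above the threshold for
        embedding a forest on \<open>w\<close> vertices.\<close>
      have d0: "0 < 4 * w + 1" by (simp add: w_def)
      have d1: "2 * (4 * w + 1) + 2 \<le> real n * (real n - 1) / C"
        using big by simp
      obtain V where V: "V \<noteq> {}" "V \<subseteq> point_pairs n"
        and pg: "pair_graph V (colour_adj c) (\<lambda>x. {fst x, snd x}) n (4 * w + 1)"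
        by (rule pair_graph_core[OF c C n d0 d1])
      obtain \<theta> where "pair_graph.embeds V (colour_adj c) (\<lambda>x. {fst x, snd x}) (verts H) (edges H) \<theta>"
        using pair_graph.forest_embeds[OF pg H(1) f V(1)] by (auto simp: w_def)
      from twin_of_embeds[OF pg V(2) _ this] show False
        using nt fin_graph_edgeE[OF H(1)] by metis
    qed
    then have "real n * (real n - 1) < (8 * w + 4) * C"
      using C by (simp add: field_simps)
    moreover have "real n ^ 2 \<le> 2 * (real n * (real n - 1))"
      using n by (simp add: power2_eq_square algebra_simps)
    moreover have "2 * ((8 * w + 4) * C) \<le> K * C"
      unfolding K_def by (simp add: algebra_simps w_def)
    ultimately show ?thesis unfolding C_def by linarith
  qed
  then show "(\<lambda>n. real (repeat_free_number 2 n H)) \<in> \<Omega>(\<lambda>n. real n ^ 2)"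
    unfolding bigomega_iff_bigo
    by (intro bigoI[where c = K] eventually_mono[OF eventually_ge_at_top[of 2]]) auto
qed

section \<open>Hexagons\<close>

context pair_graph
begin

definition codeg :: "'v \<Rightarrow> 'v \<Rightarrow> nat" where
  "codeg x y = card {z \<in> V. R x z \<and> R y z}"

text \<open>
  The threshold 12 is what closing up a heavy triangle needs: the last common neighbour has to avoid
  the at most 6 points of three earlier vertices, each of which excludes at most two candidates.
\<close>
definition light :: "'v \<Rightarrow> 'v \<Rightarrow> bool" where
  "light x y \<longleftrightarrow> pts x \<inter> pts y = {} \<and> 0 < codeg x y \<and> codeg x y \<le> 12"

definition heavy :: "'v \<Rightarrow> 'v \<Rightarrow> bool" where
  "heavy x y \<longleftrightarrow> pts x \<inter> pts y = {} \<and> 12 < codeg x y"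

text \<open>A six-cycle in the cyclic order of the arguments. Disjointness is listed for the nine
  non-adjacent pairs; adjacent vertices have it by \<open>disj\<close>.\<close>

definition hexagon :: "'v \<Rightarrow> 'v \<Rightarrow> 'v \<Rightarrow> 'v \<Rightarrow> 'v \<Rightarrow> 'v \<Rightarrow> bool" where
  "hexagon a u b v d w \<longleftrightarrow> a \<in> V \<and> u \<in> V \<and> b \<in> V \<and> v \<in> V \<and> d \<in> V \<and> w \<in> V \<and>
     R a u \<and> R u b \<and> R b v \<and> R v d \<and> R d w \<and> R w a \<and>
     pts a \<inter> pts b = {} \<and> pts a \<inter> pts v = {} \<and> pts a \<inter> pts d = {} \<and>
     pts u \<inter> pts v = {} \<and> pts u \<inter> pts d = {} \<and> pts u \<inter> pts w = {} \<and>
     pts b \<inter> pts d = {} \<and> pts b \<inter> pts w = {} \<and> pts v \<inter> pts w = {}"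

definition hexagon_free :: bool where
  "hexagon_free \<longleftrightarrow> (\<forall>a u b v d w. \<not> hexagon a u b v d w)"

lemma hexagon_freeD: "hexagon_free \<Longrightarrow> \<not> hexagon a u b v d w"
  unfolding hexagon_free_def by simp

lemma codeg_commute: "codeg x y = codeg y x"
  unfolding codeg_def by (rule arg_cong[of _ _ card]) auto

lemma heavy_commute: "heavy x y \<longleftrightarrow> heavy y x"
  unfolding heavy_def by (simp add: codeg_commute Int_commute)

text \<open>A common neighbour for each side is chosen in turn, avoiding the points of the opposite
  corner and of the neighbours already chosen: at most 2, 4 and 6 points.\<close>

lemma heavy_triangle_hexagon:
  assumes V: "a \<in> V" "b \<in> V" "d \<in> V" and h: "heavy a b" "heavy b d" "heavy d a"
  shows "\<not> hexagon_free"
proof -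
  have dj: "pts a \<inter> pts b = {}" "pts b \<inter> pts d = {}" "pts d \<inter> pts a = {}"
    and cd: "12 < card {z \<in> V. R a z \<and> R b z}" "12 < card {z \<in> V. R b z \<and> R d z}"
      "12 < card {z \<in> V. R d z \<and> R a z}"
    using h by (auto simp: heavy_def codeg_def)
  have "2 * card (pts d) < card {z \<in> V. R a z \<and> R b z}"
    using pts(2)[of d] cd(1) by linarith
  then obtain u where u: "u \<in> V" "R a u" "R b u" "pts u \<inter> pts d = {}"
    by (rule pick_neighbour[OF V(1) pts(1)])
  have "card (pts a \<union> pts u) \<le> 4"
    using card_Un_le[of "pts a" "pts u"] pts(2)[of a] pts(2)[of u] by linarith
  then have "2 * card (pts a \<union> pts u) < card {z \<in> V. R b z \<and> R d z}"
    using cd(2) by linarith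
  then obtain v where v: "v \<in> V" "R b v" "R d v" "pts v \<inter> (pts a \<union> pts u) = {}"
    by (rule pick_neighbour[OF V(2), rotated]) (use pts in auto)
  have "card (pts b \<union> (pts u \<union> pts v)) \<le> 6"
    using card_Un_le[of "pts b" "pts u \<union> pts v"] card_Un_le[of "pts u" "pts v"]
      pts(2)[of b] pts(2)[of u] pts(2)[of v] by linarith
  then have "2 * card (pts b \<union> (pts u \<union> pts v)) < card {z \<in> V. R d z \<and> R a z}"
    using cd(3) by linarith
  then obtain w where w: "w \<in> V" "R d w" "R a w" "pts w \<inter> (pts b \<union> (pts u \<union> pts v)) = {}"
    by (rule pick_neighbour[OF V(3), rotated]) (use pts in auto)
  have "hexagon a u b v d w"
    unfolding hexagon_def
    using V u v w dj sym[OF u(3)] sym[OF v(3)] sym[OF w(3)] by (auto simp: Int_Un_distrib Int_commute)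
  then show ?thesis using hexagon_freeD[of a u b v d w] by blast
qed

text \<open>Vertices of \<open>Q\<close> have the common neighbour \<open>b\<close>, so any two are
  light, heavy or share a point. Either every vertex is light to a quarter of \<open>Q\<close>, or
  one vertex has many heavy partners; among these no two are heavy, as there is no heavy triangle,
  so almost all pairs of them are light.\<close>

lemma light_pairs_in_neighbourhood:
  assumes free: hexagon_free and b: "b \<in> V" and Q: "Q \<subseteq> {y \<in> V. R b y}"
  shows "real (card Q) ^ 2 / 4 - 16 * card Q \<le> card {(x, y) \<in> Q \<times> Q. light x y}"
proof (cases "card Q < 64")
  \<comment> \<open>Below 64 the left side of the claim is at most 0.\<close>
  case True
  then have "real (card Q) * real (card Q) \<le> 64 * real (card Q)"
    by (intro mult_right_mono) auto
  then show ?thesis by (simp add: power2_eq_square)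
next
  case False
  define d where "d = real (card Q)"
  have d: "d \<ge> 64" using False by (simp add: d_def)
  have fQ: "finite Q" using Q fin by (auto intro: finite_subset)
  define close where "close x = {y \<in> Q. pts y \<inter> pts x \<noteq> {}}" for x
  define lt where "lt x = {y \<in> Q. light x y}" for x
  define hv where "hv x = {y \<in> Q. heavy x y}" for x
  have fin': "finite (close x)" "finite (lt x)" "finite (hv x)" for x
    using fQ by (auto simp: close_def lt_def hv_def)
  have cl: "card (close x) \<le> 4" for x
  proof -
    have "card (close x) \<le> card {y \<in> V. R b y \<and> pts y \<inter> pts x \<noteq> {}}"
      using Q fin by (intro card_mono) (auto simp: close_def)
    also have "\<dots> \<le> 2 * card (pts x)" by (rule hit_set[OF b pts(1)])
    finally show ?thesis using pts(2)[of x] by linarith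
  qed
  have split: "y \<in> close x \<union> lt x \<union> hv x" if "x \<in> Q" "y \<in> Q" for x y
  proof -
    have "b \<in> {z \<in> V. R x z \<and> R y z}" using that Q b sym by auto
    then have "0 < codeg x y" unfolding codeg_def using fin by (auto simp: card_gt_0_iff)
    then show ?thesis
      using that by (auto simp: close_def lt_def hv_def light_def heavy_def Int_commute)
  qed
  have "{(x, y) \<in> Q \<times> Q. light x y} = (SIGMA x:Q. lt x)" by (auto simp: lt_def)
  then have total: "card {(x, y) \<in> Q \<times> Q. light x y} = (\<Sum>x\<in>Q. card (lt x))"
    using fQ fin' by simp
  show ?thesis
  proof (cases "\<forall>x\<in>Q. d / 4 \<le> card (lt x)")
    case True
    have "d * (d / 4) = (\<Sum>x\<in>Q. d / 4)" by (simp add: d_def)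
    also have "\<dots> \<le> (\<Sum>x\<in>Q. real (card (lt x)))"
      using True by (intro sum_mono) auto
    also have "\<dots> = card {(x, y) \<in> Q \<times> Q. light x y}"
      by (simp only: total of_nat_sum)
    finally have "d * (d / 4) \<le> card {(x, y) \<in> Q \<times> Q. light x y}" .
    then show ?thesis using d unfolding d_def[symmetric] by (simp add: power2_eq_square)
  next
    case False
    then obtain x where x: "x \<in> Q" "card (lt x) < d / 4" by auto
    define h where "h = real (card (hv x))"
    have "card Q \<le> card (close x \<union> lt x \<union> hv x)"
      using split[OF x(1)] fin' by (intro card_mono) auto
    also have "\<dots> \<le> card (close x) + card (lt x) + card (hv x)"
      by (meson add_mono card_Un_le order_refl order_trans)
    finally have h: "h \<ge> 3 / 4 * d - 4"
      using cl[of x] x(2) by (simp add: d_def h_def)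
    have "h - 4 \<le> card (lt y)" if y: "y \<in> hv x" for y
    proof -
      have yQ: "y \<in> Q" "heavy x y" using y by (auto simp: hv_def)
      have "hv x \<subseteq> close y \<union> lt y"
      proof
        fix z assume z: "z \<in> hv x"
        then have zQ: "z \<in> Q" "heavy x z" by (auto simp: hv_def)
        have "z \<notin> hv y"
          using heavy_triangle_hexagon[of x y z] free x yQ zQ Q heavy_commute[of x z]
          by (auto simp: hv_def)
        then show "z \<in> close y \<union> lt y" using split[OF yQ(1) zQ(1)] by simp
      qed
      then have "card (hv x) \<le> card (close y \<union> lt y)"
        using fin' by (intro card_mono) auto
      also have "\<dots> \<le> card (close y) + card (lt y)" by (rule card_Un_le)
      finally show ?thesis using cl[of y] by (simp add: h_def)
    qed
    then have "(\<Sum>y\<in>hv x. h - 4) \<le> (\<Sum>y\<in>hv x. real (card (lt y)))"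
      by (rule sum_mono)
    also have "\<dots> \<le> (\<Sum>y\<in>Q. real (card (lt y)))"
      using fQ by (intro sum_mono2) (auto simp: hv_def)
    also have "\<dots> = card {(x, y) \<in> Q \<times> Q. light x y}"
      by (simp only: total of_nat_sum)
    also have "(\<Sum>y\<in>hv x. h - 4) = h * (h - 4)" by (simp add: h_def)
    finally have "h * (h - 4) \<le> card {(x, y) \<in> Q \<times> Q. light x y}" .
    \<comment> \<open>Here \<open>h - 4\<close> is at least \<open>3 / 4 * d - 8\<close>, which is
      at least \<open>d / 2\<close> because \<open>d\<close> is at least 64.\<close>
    moreover have "(d / 2) * (d / 2) \<le> h * (h - 4)"
      using h d by (intro mult_mono) auto
    ultimately show ?thesis using d unfolding d_def[symmetric] by (simp add: power2_eq_square)
  qed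
qed

text \<open>Light pairs are double counted inside the sets \<open>Q b\<close>: each is seen from at
  most 12 vertices \<open>b\<close>, while the sizes of the \<open>Q b\<close> add up to at least
  \<open>D * card U\<close>. Cauchy-Schwarz over \<open>b\<close> finishes.\<close>

lemma many_light_pairs:
  assumes free: hexagon_free and U: "U \<subseteq> V" and ne: "V \<noteq> {}" and D: "0 \<le> D"
    and big: "128 * real (card V) \<le> D * real (card U)"
  shows "(D * card U) ^ 2 \<le> 96 * real (card V) * real (card {(x, y) \<in> U \<times> U. light x y})"
proof -
  have fU: "finite U" using U fin by (rule finite_subset)
  define L where "L = {(x, y) \<in> U \<times> U. light x y}"
  have fL: "finite L" by (rule finite_subset[of _ "U \<times> U"]) (use fU in \<open>auto simp: L_def\<close>)
  define Q where "Q b = {y \<in> U. R b y}" for b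
  define T where "T = (\<Sum>b\<in>V. real (card (Q b)))"
  have "D * card U = (\<Sum>x\<in>U. D)" by simp
  also have "\<dots> \<le> (\<Sum>x\<in>U. real (card {b \<in> V. R x b}))"
    using U min_deg by (intro sum_mono) auto
  also have "\<dots> = (\<Sum>x\<in>U. \<Sum>b | b \<in> V \<and> R x b. 1)" by simp
  also have "\<dots> = (\<Sum>b\<in>V. \<Sum>x | x \<in> U \<and> R x b. 1)"
    by (rule sum.swap_restrict[OF fU fin])
  also have "\<dots> = T"
    unfolding T_def Q_def using sym by (intro sum.cong refl) (auto intro!: arg_cong[of _ _ card])
  finally have T: "D * card U \<le> T" .
  have "(\<Sum>b\<in>V. real (card {(x, y) \<in> Q b \<times> Q b. light x y}))
      = (\<Sum>b\<in>V. \<Sum>p | p \<in> L \<and> (R b (fst p) \<and> R b (snd p)). 1)"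
    by (auto simp: L_def Q_def intro!: sum.cong arg_cong[of _ _ card])
  also have "\<dots> = (\<Sum>p\<in>L. \<Sum>b | b \<in> V \<and> (R b (fst p) \<and> R b (snd p)). 1)"
    by (rule sum.swap_restrict[OF fin fL])
  also have "\<dots> \<le> (\<Sum>p\<in>L. 12)"
  proof (rule sum_mono)
    fix p assume "p \<in> L"
    then have "codeg (fst p) (snd p) \<le> 12" by (auto simp: L_def light_def)
    moreover have "{b \<in> V. R b (fst p) \<and> R b (snd p)} = {b \<in> V. R (fst p) b \<and> R (snd p) b}"
      using sym by auto
    ultimately show "(\<Sum>b | b \<in> V \<and> (R b (fst p) \<and> R b (snd p)). 1) \<le> (12 :: real)"
      by (simp add: codeg_def)
  qed
  finally have "(\<Sum>b\<in>V. real (card {(x, y) \<in> Q b \<times> Q b. light x y})) \<le> 12 * card L" by simp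
  moreover have "(\<Sum>b\<in>V. real (card (Q b)) ^ 2 / 4 - 16 * card (Q b))
      \<le> (\<Sum>b\<in>V. real (card {(x, y) \<in> Q b \<times> Q b. light x y}))"
    using U by (intro sum_mono light_pairs_in_neighbourhood[OF free]) (auto simp: Q_def)
  moreover have "(\<Sum>b\<in>V. real (card (Q b)) ^ 2 / 4 - 16 * card (Q b))
      = (\<Sum>b\<in>V. real (card (Q b)) ^ 2) / 4 - 16 * T"
    by (simp add: T_def sum_subtractf sum_distrib_left sum_divide_distrib)
  ultimately have "(\<Sum>b\<in>V. real (card (Q b)) ^ 2) / 4 - 16 * T \<le> 12 * card L" by linarith
  then have "((\<Sum>b\<in>V. real (card (Q b)) ^ 2) / 4 - 16 * T) * card V \<le> 12 * real (card L) * card V"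
    by (intro mult_right_mono) auto
  moreover have "T ^ 2 \<le> (\<Sum>b\<in>V. real (card (Q b)) ^ 2) * card V"
    unfolding T_def by (rule sum_squared_le_sum_of_squares)
  \<comment> \<open>The factor 128 makes the error \<open>16 * T\<close> at most half of the main
    term \<open>T ^ 2 / (4 * card V)\<close>; together with the multiplicity 12 this leaves 8 * 12 =
    96.\<close>
  moreover have "128 * real (card V) * T \<le> T * T"
    using T big by (intro mult_right_mono) (auto simp: T_def sum_nonneg)
  ultimately have "T ^ 2 \<le> 96 * real (card V) * real (card L)"
    by (simp add: algebra_simps power2_eq_square)
  moreover have "(D * card U) ^ 2 \<le> T ^ 2"
    using T D by (intro power_mono) auto
  ultimately show ?thesis by (simp add: L_def)
qed

text \<open>At most 4 middle vertices meet \<open>Z\<close>, each with at most \<open>n\<close>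
  continuations.\<close>

lemma two_step_middle:
  assumes p: "p \<in> V" and Z: "finite Z" "card Z \<le> 2"
  shows "card {y \<in> V. \<exists>z \<in> V. R p z \<and> pts z \<inter> Z \<noteq> {} \<and> R z y} \<le> 4 * n"
proof -
  let ?M = "{z \<in> V. R p z \<and> pts z \<inter> Z \<noteq> {}}"
  have M: "card ?M \<le> 4" using hit_set[OF p Z(1)] Z(2) by linarith
  have "{y \<in> V. \<exists>z \<in> V. R p z \<and> pts z \<inter> Z \<noteq> {} \<and> R z y} = (\<Union>z\<in>?M. {y \<in> V. R z y})" by auto
  then have "card {y \<in> V. \<exists>z \<in> V. R p z \<and> pts z \<inter> Z \<noteq> {} \<and> R z y} \<le> (\<Sum>z\<in>?M. card {y \<in> V. R z y})"
    using card_UN_le[of ?M "\<lambda>z. {y \<in> V. R z y}"] fin by simp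
  also have "\<dots> \<le> (\<Sum>z\<in>?M. n)"
    using max_deg by (intro sum_mono) auto
  also have "\<dots> \<le> 4 * n" using M by simp
  finally show ?thesis .
qed

text \<open>Now the middle vertex has up to \<open>n\<close> choices, each allowing at most 4 ends
  that meet \<open>Z\<close>.\<close>

lemma two_step_end:
  assumes p: "p \<in> V" and Z: "finite Z" "card Z \<le> 2"
  shows "card {y \<in> V. \<exists>z \<in> V. R p z \<and> R z y \<and> pts y \<inter> Z \<noteq> {}} \<le> 4 * n"
proof -
  let ?M = "{z \<in> V. R p z}"
  have "{y \<in> V. \<exists>z \<in> V. R p z \<and> R z y \<and> pts y \<inter> Z \<noteq> {}} = (\<Union>z\<in>?M. {y \<in> V. R z y \<and> pts y \<inter> Z \<noteq> {}})"
    by auto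
  then have "card {y \<in> V. \<exists>z \<in> V. R p z \<and> R z y \<and> pts y \<inter> Z \<noteq> {}}
      \<le> (\<Sum>z\<in>?M. card {y \<in> V. R z y \<and> pts y \<inter> Z \<noteq> {}})"
    using card_UN_le[of ?M "\<lambda>z. {y \<in> V. R z y \<and> pts y \<inter> Z \<noteq> {}}"] fin by simp
  also have "\<dots> \<le> (\<Sum>z\<in>?M. 4)"
  proof (rule sum_mono)
    fix z assume "z \<in> ?M"
    then show "card {y \<in> V. R z y \<and> pts y \<inter> Z \<noteq> {}} \<le> 4"
      using hit_set[of z Z] Z by force
  qed
  also have "\<dots> \<le> 4 * n" using max_deg[OF p] by simp
  finally show ?thesis .
qed

text \<open>For \<open>x\<close> and \<open>y\<close> light to each other and to \<open>r\<close>,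
  common neighbours give a closed walk \<open>r\<close>, \<open>m x\<close>, \<open>x\<close>,
  \<open>z\<close>, \<open>y\<close>, \<open>m y\<close>. Without hexagons two non-adjacent vertices
  on it share a point, and for a fixed end each such coincidence leaves O(n) choices for the
  other.\<close>

lemma few_light_pairs:
  assumes free: hexagon_free and r: "r \<in> V" and U: "U = {y \<in> V. light r y}"
  shows "card {(x, y) \<in> U \<times> U. light x y} \<le> 32 * n * card U"
proof -
  have fU: "finite U" using U fin by simp
  have "\<exists>z. z \<in> V \<and> R r z \<and> R x z" if x: "x \<in> U" for x
  proof -
    have "{z \<in> V. R r z \<and> R x z} \<noteq> {}"
      using x by (auto simp: U light_def codeg_def card_gt_0_iff)
    then show ?thesis by blast
  qed
  then obtain m where m: "\<And>x. x \<in> U \<Longrightarrow> m x \<in> V \<and> R r (m x) \<and> R x (m x)" by metis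
  \<comment> \<open>In this order the sets handle a point shared by \<open>z\<close> and
    \<open>r\<close>, by \<open>z\<close> and \<open>m x\<close>, by \<open>y\<close> and
    \<open>m x\<close>, and by \<open>m y\<close> and \<open>m x\<close>. Exchanging
    \<open>x\<close> and \<open>y\<close>, the second and third handle \<open>z\<close> with
    \<open>m y\<close> and \<open>x\<close> with \<open>m y\<close>; this is the mirror image below,
    which turns 16 into 32. Lightness covers the remaining three pairs.\<close>
  define S1 where "S1 x = {y \<in> V. \<exists>z \<in> V. R x z \<and> pts z \<inter> pts r \<noteq> {} \<and> R z y}" for x
  define S2 where "S2 x = {y \<in> V. \<exists>z \<in> V. R x z \<and> pts z \<inter> pts (m x) \<noteq> {} \<and> R z y}" for x
  define S3 where "S3 x = {y \<in> V. \<exists>z \<in> V. R r z \<and> R z y \<and> pts y \<inter> pts (m x) \<noteq> {}}" for x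
  define S4 where "S4 x = {y \<in> V. \<exists>z \<in> V. R r z \<and> pts z \<inter> pts (m x) \<noteq> {} \<and> R z y}" for x
  define B where "B x = S1 x \<union> S2 x \<union> S3 x \<union> S4 x" for x
  have cB: "card (B x) \<le> 16 * n" if x: "x \<in> U" for x
  proof -
    have xV: "x \<in> V" using x U by simp
    have "card (B x) \<le> card (S1 x) + card (S2 x) + card (S3 x) + card (S4 x)"
      unfolding B_def by (meson add_mono card_Un_le order_refl order_trans)
    also have "\<dots> \<le> 4 * n + 4 * n + 4 * n + 4 * n"
      unfolding S1_def S2_def S3_def S4_def
      by (intro add_mono two_step_middle two_step_end xV r pts)
    finally show ?thesis by simp
  qed
  have fB: "finite (B x)" for x
    using fin by (simp add: B_def S1_def S2_def S3_def S4_def)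
  have "{(x, y) \<in> U \<times> U. light x y} \<subseteq> (SIGMA x:U. B x) \<union> prod.swap ` (SIGMA x:U. B x)"
  proof clarify
    fix x y assume xy: "x \<in> U" "y \<in> U" "light x y" "(x, y) \<notin> prod.swap ` Sigma U B"
    then have xB: "x \<notin> B y" by (metis SigmaI pair_in_swap_image)
    have xyV: "x \<in> V" "y \<in> V" and rx: "pts r \<inter> pts x = {}" "pts r \<inter> pts y = {}"
      using xy U by (auto simp: light_def)
    have "{z \<in> V. R x z \<and> R y z} \<noteq> {}"
      using xy(3) by (auto simp: light_def codeg_def card_gt_0_iff)
    then obtain z where z: "z \<in> V" "R x z" "R y z" by blast
    note mx = m[OF xy(1)] and my = m[OF xy(2)]
    have mx': "m x \<in> V" "R r (m x)" "R (m x) x" and my': "m y \<in> V" "R r (m y)" "R (m y) y" "R y (m y)" "R (m y) r"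
      and z': "R z y" "R z x"
      using mx my z sym by blast+
    show "y \<in> B x"
    proof (rule ccontr)
      assume yB: "y \<notin> B x"
      have y: "y \<notin> S1 x" "y \<notin> S2 x" "y \<notin> S3 x" "y \<notin> S4 x" and x: "x \<notin> S2 y" "x \<notin> S3 y"
        using yB xB by (simp_all add: B_def)
      have "pts z \<inter> pts r = {}"
        using y(1) xyV z z' unfolding S1_def by blast
      moreover have "pts z \<inter> pts (m x) = {}"
        using y(2) xyV z z' unfolding S2_def by blast
      moreover have "pts y \<inter> pts (m x) = {}"
        using y(3) xyV my' unfolding S3_def by blast
      moreover have "pts (m y) \<inter> pts (m x) = {}"
        using y(4) xyV my' unfolding S4_def by blast
      moreover have "pts x \<inter> pts (m y) = {}"
        using x(2) xyV mx' unfolding S3_def by blast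
      moreover have "pts z \<inter> pts (m y) = {}"
        using x(1) xyV z z' unfolding S2_def by blast
      moreover have "pts x \<inter> pts y = {}" using xy(3) by (simp add: light_def)
      ultimately have "hexagon r (m x) x z y (m y)"
        unfolding hexagon_def using r xyV rx z z' mx' my' by (simp add: Int_commute)
      then show False using hexagon_freeD[OF free] by simp
    qed
  qed
  then have "card {(x, y) \<in> U \<times> U. light x y} \<le> card ((SIGMA x:U. B x) \<union> prod.swap ` (SIGMA x:U. B x))"
    using fU fB by (intro card_mono) auto
  also have "\<dots> \<le> card (SIGMA x:U. B x) + card (prod.swap ` (SIGMA x:U. B x))"
    by (rule card_Un_le)
  also have "\<dots> \<le> card (SIGMA x:U. B x) + card (SIGMA x:U. B x)"
    using fU fB by (intro add_mono card_image_le order_refl finite_SigmaI)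
  also have "card (SIGMA x:U. B x) = (\<Sum>x\<in>U. card (B x))" using fU fB by simp
  also have "(\<Sum>x\<in>U. card (B x)) \<le> (\<Sum>x\<in>U. 16 * n)" using cB by (intro sum_mono)
  finally show ?thesis by simp
qed

text \<open>Applied to \<open>V\<close>, \<open>many_light_pairs\<close> yields a vertex
  \<open>r\<close> light to a set \<open>U\<close> of size at least \<open>D ^ 2 / 96\<close>;
  applied to \<open>U\<close>, it contradicts \<open>few_light_pairs\<close>. The constant is 96 *
  3072, where 3072 = 96 * 32.\<close>

lemma hexagon_exists:
  assumes ne: "V \<noteq> {}" and V: "card V \<le> n ^ 2" and D: "0 < D" "294912 * real n ^ 3 < D ^ 4"
  shows "\<not> hexagon_free"
proof
  assume free: hexagon_free
  define N where "N = real n"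
  obtain v where "v \<in> V" using ne by blast
  then have DN: "D \<le> N" using min_deg[of v] max_deg[of v] by (simp add: N_def)
  then have N: "N > 0" using D by linarith
  have D4: "294912 * N ^ 3 < D ^ 4" using D by (simp add: N_def)
  \<comment> \<open>As \<open>D\<close> is at most \<open>N\<close>, the bound on
    \<open>D ^ 4\<close> descends to \<open>D ^ 3\<close> and to \<open>D\<close>. These supply the
    size condition of \<open>many_light_pairs\<close> for \<open>U\<close> and for \<open>V\<close>
    respectively.\<close>
  have "D ^ 4 \<le> N * D ^ 3"
    using DN D by (simp add: power4_eq_xxxx power3_eq_cube)
  then have "N * (294912 * N ^ 2) < N * D ^ 3"
    using D4 by (simp add: power2_eq_square power3_eq_cube)
  then have D3: "294912 * N ^ 2 < D ^ 3" using N by simp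
  have "D ^ 3 \<le> D * N ^ 2"
    using DN D by (simp add: power2_eq_square power3_eq_cube mult_mono)
  also have "\<dots> = N ^ 2 * D" by simp
  finally have "N ^ 2 * 294912 < N ^ 2 * D" using D3 by simp
  then have D1: "294912 < D" using N by simp
  have VN: "real (card V) \<le> N ^ 2"
    using V unfolding N_def by (metis of_nat_le_iff of_nat_power)
  have Vpos: "0 < real (card V)" using ne fin by (simp add: card_gt_0_iff)
  have "128 * real (card V) \<le> D * real (card V)"
    using D1 by (intro mult_right_mono) auto
  then have "(D * card V) ^ 2 \<le> 96 * real (card V) * real (card {(x, y) \<in> V \<times> V. light x y})"
    using D by (intro many_light_pairs[OF free order.refl ne]) auto
  then have "real (card V) * (D ^ 2 * card V) \<le> card V * (96 * real (card {(x, y) \<in> V \<times> V. light x y}))"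
    by (simp add: power2_eq_square mult_ac)
  then have tot: "D ^ 2 * card V \<le> 96 * real (card {(x, y) \<in> V \<times> V. light x y})"
    using Vpos by (rule mult_left_le_imp_le)
  have "{(x, y) \<in> V \<times> V. light x y} = (SIGMA x:V. {y \<in> V. light x y})" by auto
  then have cs: "card {(x, y) \<in> V \<times> V. light x y} = (\<Sum>x\<in>V. card {y \<in> V. light x y})"
    using fin by simp
  have "\<exists>r\<in>V. D ^ 2 \<le> 96 * real (card {y \<in> V. light r y})"
  proof (rule ccontr)
    assume "\<not> ?thesis"
    then have "(\<Sum>x\<in>V. 96 * real (card {y \<in> V. light x y})) < (\<Sum>x\<in>V. D ^ 2)"
      using fin ne by (intro sum_strict_mono) (auto simp: not_le)
    then show False using tot by (simp only: cs of_nat_sum sum_distrib_left) (simp add: mult.commute)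
  qed
  then obtain r where r: "r \<in> V" "D ^ 2 \<le> 96 * real (card {y \<in> V. light r y})" by blast
  define U where "U = {y \<in> V. light r y}"
  have rU: "D ^ 2 \<le> 96 * card U" using r(2) by (simp add: U_def)
  have "0 < D ^ 2" using D by simp
  then have Upos: "0 < real (card U)" using rU by linarith
  have "D * D ^ 2 \<le> D * (96 * card U)"
    using rU D by (intro mult_left_mono) auto
  then have "D ^ 3 \<le> 96 * (D * card U)" by (simp add: power2_eq_square power3_eq_cube)
  then have "128 * real (card V) \<le> D * real (card U)" using D3 VN by linarith
  then have "(D * card U) ^ 2 \<le> 96 * real (card V) * real (card {(x, y) \<in> U \<times> U. light x y})"
    using D by (intro many_light_pairs[OF free _ ne]) (auto simp: U_def)
  also have "\<dots> \<le> 96 * N ^ 2 * (32 * N * card U)"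
  proof (rule mult_mono)
    show "96 * real (card V) \<le> 96 * N ^ 2" using VN by simp
    have "card {(x, y) \<in> U \<times> U. light x y} \<le> 32 * n * card U"
      by (rule few_light_pairs[OF free r(1) U_def])
    then have "real (card {(x, y) \<in> U \<times> U. light x y}) \<le> real (32 * n * card U)"
      by (rule of_nat_mono)
    then show "real (card {(x, y) \<in> U \<times> U. light x y}) \<le> 32 * N * card U"
      by (simp only: N_def of_nat_mult of_nat_numeral)
  qed auto
  finally have "real (card U) * (D ^ 2 * card U) \<le> card U * (3072 * N ^ 3)"
    by (simp add: power2_eq_square power3_eq_cube mult_ac)
  then have "D ^ 2 * card U \<le> 3072 * N ^ 3" using Upos by (rule mult_left_le_imp_le)
  moreover have "D ^ 2 * D ^ 2 \<le> D ^ 2 * (96 * card U)"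
    using rU by (intro mult_left_mono) auto
  ultimately have "D ^ 4 \<le> 294912 * N ^ 3"
    by (simp add: power2_eq_square power4_eq_xxxx)
  then show False using D4 by simp
qed

end

section \<open>The six-cycle lies strictly between linear and quadratic growth\<close>

definition hexagon_graph :: "nat sgraph" where
  "hexagon_graph = \<lparr>verts = {..<6}, edges = {{0, 1}, {1, 2}, {2, 3}, {3, 4}, {4, 5}, {5, 0}}\<rparr>"

lemma hexagon_graph:
  "fin_graph hexagon_graph" "edges hexagon_graph \<noteq> {}" "bipartite hexagon_graph" "\<not> forest hexagon_graph"
proof -
  show "fin_graph hexagon_graph" "edges hexagon_graph \<noteq> {}"
    by (auto simp: fin_graph_def hexagon_graph_def)
  show "bipartite hexagon_graph"
    unfolding bipartite_def
  proof (intro exI conjI)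
    show "{0, 2, 4} \<union> {1, 3, 5} = verts hexagon_graph"
      by (auto simp: hexagon_graph_def)
    show "\<forall>e\<in>edges hexagon_graph. \<exists>a\<in>{0, 2, 4}. \<exists>b\<in>{1, 3, 5}. e = {a, b}"
      by (simp add: hexagon_graph_def doubleton_eq_iff)
  qed auto
  have "is_cycle hexagon_graph [0, 1, 2, 3, 4, 5]"
    unfolding is_cycle_def
  proof (intro conjI allI impI)
    fix i assume "i < length [0, 1, 2, 3, 4, 5 :: nat]"
    then consider "i = 0" | "i = 1" | "i = 2" | "i = 3" | "i = 4" | "i = 5" by fastforce
    then show "{[0, 1, 2, 3, 4, 5] ! i, [0, 1, 2, 3, 4, 5] ! (Suc i mod length [0, 1, 2, 3, 4, 5 :: nat])}
        \<in> edges hexagon_graph"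
      by cases (simp_all add: hexagon_graph_def)
  qed simp_all
  then show "\<not> forest hexagon_graph" by (auto simp: forest_def)
qed

lemma (in pair_graph) embeds_hexagon_graph:
  assumes "\<not> hexagon_free"
  obtains \<theta> where "embeds (verts hexagon_graph) (edges hexagon_graph) \<theta>"
proof -
  obtain a u b v d w where h: "hexagon a u b v d w" 
    using assms unfolding hexagon_free_def not_all not_not by (elim exE)
  define \<theta> where "\<theta> i = [a, u, b, v, d, w] ! i" for i :: nat
  have th: "\<theta> 0 = a" "\<theta> 1 = u" "\<theta> 2 = b" "\<theta> 3 = v" "\<theta> 4 = d" "\<theta> 5 = w" "\<theta> (Suc 0) = u"
    by (simp_all add: \<theta>_def)
  have six: "{..<6} = {0, 1, 2, 3, 4, 5 :: nat}" by auto
  have "embeds (verts hexagon_graph) (edges hexagon_graph) \<theta>"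
    using h disj[of a u] disj[of u b] disj[of b v] disj[of v d] disj[of d w] disj[of w a]
      sym[of a u] sym[of u b] sym[of b v] sym[of v d] sym[of d w] sym[of w a]
    unfolding embeds_def hexagon_graph_def hexagon_def sgraph.select_convs six
    by (simp add: th doubleton_eq_iff Int_commute)
  then show thesis by (rule that)
qed

text \<open>With at most \<open>n powr (9 / 8)\<close> colours the average degree is at least of
  order \<open>n powr (7 / 8)\<close>, whose fourth power beats \<open>n ^ 3\<close>. The same
  calculation allows every exponent below 5 / 4.\<close>

lemma hexagon_lower:
  "\<forall>\<^sub>F n in at_top. real n powr (1 + 1 / 8) \<le> real (repeat_free_number 2 n hexagon_graph)"
proof -
  have e1: "\<forall>\<^sub>F n in at_top. 2 * (real n powr (7 / 8) / 8) + 2 \<le> real n * (real n - 1) / real n powr (9 / 8)"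
    by real_asymp
  have e2: "\<forall>\<^sub>F n in at_top. 294912 * real n ^ 3 < (real n powr (7 / 8) / 8) ^ 4"
    by real_asymp
  show ?thesis
    using eventually_ge_at_top[of 2] e1 e2
  proof eventually_elim
    case (elim n)
    define C where "C = repeat_free_number 2 n hexagon_graph"
    define D where "D = real n powr (7 / 8) / 8"
    obtain c where c: "proper_colouring (complete_graph n) C c"
      and nt: "\<And>\<alpha> \<beta>. \<not> twin n c (verts hexagon_graph) (edges hexagon_graph) \<alpha> \<beta>"
      using repeat_free_number_colouring[OF hexagon_graph(1,2)] unfolding C_def by metis
    have C: "C > 0"
      using repeat_free_number_ge[OF hexagon_graph(1,2), of n] elim by (simp add: C_def)
    have D: "0 < D" using elim by (simp add: D_def)
    show ?case
    proof (rule ccontr)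
      assume "\<not> ?case"
      then have "real C \<le> real n powr (9 / 8)" by (simp add: C_def)
      then have "real n * (real n - 1) / real n powr (9 / 8) \<le> real n * (real n - 1) / C"
        using C elim by (intro divide_left_mono mult_nonneg_nonneg mult_pos_pos) auto
      with elim have d1: "2 * D + 2 \<le> real n * (real n - 1) / C" unfolding D_def by linarith
      obtain V where V: "V \<noteq> {}" "V \<subseteq> point_pairs n"
        and pg: "pair_graph V (colour_adj c) (\<lambda>x. {fst x, snd x}) n D"
        using elim(1) by (rule pair_graph_core[OF c C _ D d1])
      have "card V \<le> card (point_pairs n)"
        using V(2) point_pairs_card(1) by (rule card_mono[rotated])
      also have "\<dots> \<le> n ^ 2" by (simp add: point_pairs_card power2_eq_square)
      finally have "\<not> pair_graph.hexagon_free V (colour_adj c) (\<lambda>x. {fst x, snd x})"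
        using elim by (intro pair_graph.hexagon_exists[OF pg V(1) _ D]) (simp_all add: D_def)
      then obtain \<theta> where "pair_graph.embeds V (colour_adj c) (\<lambda>x. {fst x, snd x})
          (verts hexagon_graph) (edges hexagon_graph) \<theta>"
        by (rule pair_graph.embeds_hexagon_graph[OF pg])
      from twin_of_embeds[OF pg V(2) _ this] show False
        using nt fin_graph_edgeE[OF hexagon_graph(1)] by metis
    qed
  qed
qed

text \<open>Graphs without edges are excluded because the minimum need not exist for them. The
  witness for (iv) lives on \<open>nat\<close>, since the type variable may stand for a type with
  too few elements.\<close>

theorem theorem1p3:
  shows
    "(\<forall>H :: 'a sgraph. fin_graph H \<and> edges H \<noteq> {} \<longrightarrow>
        (forest H \<longrightarrow>
           (\<lambda>n. real (repeat_free_number 2 n H)) \<in> \<Theta>[at_top](\<lambda>n. real n ^ 2)) \<and>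
        (\<not> forest H \<longrightarrow>
           (\<exists>\<epsilon>>0. (\<lambda>n. real (repeat_free_number 2 n H)) \<in> O[at_top](\<lambda>n. real n powr (2 - \<epsilon>)))) \<and>
        (\<not> bipartite H \<longrightarrow>
           (\<forall>n\<ge>2. repeat_free_number 2 n H \<le> n + 1)) \<and>
        (bipartite H \<and> int (card (edges H)) \<ge> 2 * int (card (verts H)) - 2 \<longrightarrow>
           (\<lambda>n. real (repeat_free_number 2 n H)) \<in> \<Theta>[at_top](\<lambda>n. real n)))
     \<and> (\<exists>H :: nat sgraph. fin_graph H \<and> edges H \<noteq> {} \<and> bipartite H \<and>
        (\<exists>\<epsilon>>0. \<forall>\<^sub>F n in at_top.
           real n powr (1 + \<epsilon>) \<le> real (repeat_free_number 2 n H) \<and>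
           real (repeat_free_number 2 n H) \<le> real n powr (2 - \<epsilon>)))"
proof (intro conjI allI impI)
  fix H :: "'a sgraph" assume H: "fin_graph H \<and> edges H \<noteq> {}"
  then have H': "fin_graph H" "edges H \<noteq> {}" by simp_all
  show "(\<lambda>n. real (repeat_free_number 2 n H)) \<in> \<Theta>[at_top](\<lambda>n. real n ^ 2)" if "forest H"
    using forest_bigtheta[OF H' that] .
  show "\<exists>\<epsilon>>0. (\<lambda>n. real (repeat_free_number 2 n H)) \<in> O[at_top](\<lambda>n. real n powr (2 - \<epsilon>))" if "\<not> forest H"
    by (rule nonforest_bigo[OF H' that]) blast
  show "repeat_free_number 2 n H \<le> n + 1" if "\<not> bipartite H" for n
    using nonbipartite_upper[OF H' that] .
  show "(\<lambda>n. real (repeat_free_number 2 n H)) \<in> \<Theta>[at_top](\<lambda>n. real n)"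
    if "bipartite H \<and> int (card (edges H)) \<ge> 2 * int (card (verts H)) - 2"
    using dense_bigtheta[OF H'] that by blast
next
  obtain \<epsilon> :: real where e: "\<epsilon> > 0"
    and O: "(\<lambda>n. real (repeat_free_number 2 n hexagon_graph)) \<in> O(\<lambda>n. real n powr (2 - \<epsilon>))"
    by (rule nonforest_bigo[OF hexagon_graph(1,2,4)])
  obtain K where K: "K > 0"
    "\<forall>\<^sub>F n in at_top. norm (real (repeat_free_number 2 n hexagon_graph)) \<le> K * norm (real n powr (2 - \<epsilon>))"
    by (rule landau_o.bigE[OF O])
  \<comment> \<open>The value 1 / 8 comes from the lower bound. Only half of \<epsilon> is kept in
    the upper bound, so that the other half absorbs the constant \<open>K\<close>.\<close>
  define \<delta> where "\<delta> = min (1 / 8) (\<epsilon> / 2)"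
  have d: "\<delta> > 0" "\<delta> \<le> 1 / 8" "\<delta> \<le> \<epsilon> / 2" using e by (auto simp: \<delta>_def)
  have absorb: "\<forall>\<^sub>F n in at_top. K * real n powr (2 - \<epsilon>) \<le> real n powr (2 - \<epsilon> / 2)"
    using e K(1) by real_asymp
  have "\<forall>\<^sub>F n in at_top. real n powr (1 + \<delta>) \<le> real (repeat_free_number 2 n hexagon_graph) \<and>
      real (repeat_free_number 2 n hexagon_graph) \<le> real n powr (2 - \<delta>)"
    using hexagon_lower K(2) absorb eventually_ge_at_top[of 1]
  proof eventually_elim
    case (elim n)
    have "real n powr (1 + \<delta>) \<le> real n powr (1 + 1 / 8)"
      using elim d by (intro powr_mono) auto
    moreover have "real n powr (2 - \<epsilon> / 2) \<le> real n powr (2 - \<delta>)"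
      using elim d by (intro powr_mono) auto
    ultimately show ?case using elim by simp
  qed
  then show "\<exists>H :: nat sgraph. fin_graph H \<and> edges H \<noteq> {} \<and> bipartite H \<and>
      (\<exists>\<epsilon>>0. \<forall>\<^sub>F n in at_top. real n powr (1 + \<epsilon>) \<le> real (repeat_free_number 2 n H) \<and>
         real (repeat_free_number 2 n H) \<le> real n powr (2 - \<epsilon>))"
    using hexagon_graph d(1) by blast
qed

end
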